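(* Fix $q\in\mathbb{C}$ with $|q|>1$. Let $N\geq 1$, $p\in\mathbb{N}$ and $\alpha\in\mathbb{N}^+$. Let $F(x,\epsilon,y)$ be a $\mathbb{C}^N$-valued function, analytic in a neighborhood of $(0,0,0)\in\mathbb{C}\times\mathbb{C}\times\mathbb{C}^N$, such that $F(0,0,0)=0$ and the Jacobian matrix $D_yF(0,0,0)\in\mathbb{C}^{N\times N}$ of $F$ with respect to $y$ is invertible. Consider each one of the two systems $$\epsilon^\alpha x^{p+1}d_{q,x}(y)(x,\epsilon)=F(x,\epsilon,y),\qquad\qquad \epsilon^\alpha x^{p}\sigma_{q,x}(y)(x,\epsilon)=F(x,\epsilon,y),$$ with unknown $y\in\mathbb{C}^N$. Then each system has a unique formal power series solution $\hat{y}(x,\epsilon)\in\mathbb{C}[[x,\epsilon]]^N$ (with $\hat y(0,0)=0$). Write it as $$\hat{y}(x,\epsilon)=\sum_{n=0}^\infty y_n(\epsilon)x^n=\sum_{n=0}^\infty u_n(x)\epsilon^n .$$ Moreover, for each of the two systems: (1) If $p>0$, there is $r>0$ such that, for all $n\ge 0$, the entries of $y_n$ belong to $\mathcal{O}_b(D_r)$ and the entries of $u_n$ belong to $\mathcal{O}_b(D_{r/|q|^{\lfloor n/\alpha\rfloor}})$, and there are constants $C=C(q)>0$, $A=A(q)>0$ such that, for all $n\geq 0$, $$\sup_{|\epsilon|< r}|y_n(\epsilon)|\leq CA^n|q|^{\frac{n^2}{2p}},\qquad \sup_{|x|< r/|q|^{\lfloor n/\alpha\rfloor}}|u_n(x)|\leq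 CA^n.$$ (2) If $p=0$, there is $r>0$ such that, for all $n\ge 0$, the entries of $y_n$ belong to $\mathcal{O}_b(D_{r/|q|^{n/\alpha}})$ and the entries of $u_n$ belong to $\mathcal{O}_b(D_{r/|q|^{\lfloor n/\alpha\rfloor}})$, and there are constants $C=C(q)>0$, $A=A(q)>0$ such that, for all $n\geq 0$, $$\sup_{|\epsilon|< r/|q|^{n/\alpha}}|y_n(\epsilon)|\leq CA^n,\qquad \sup_{|x|< r/|q|^{\lfloor n/\alpha\rfloor}}|u_n(x)|\leq CA^n.$$
   Context: $\mathbb{N}$ denotes the non-negative integers and $\mathbb{N}^+=\mathbb{N}\setminus\{0\}$. For $R>0$, $D_R=\{x\in\mathbb{C}:|x|<R\}$, and $\mathcal{O}_b(D_R)$ is the space of bounded holomorphic functions $D_R\to\mathbb{C}$. A formal power series in one variable is said to belong to $\mathcal{O}_b(D_R)$ if it converges on $D_R$ to a bounded holomorphic function. For vectors in $\mathbb{C}^N$, $|\cdot|$ is the maximum norm. For a function or formal power series $y(x,\epsilon)$, the operators $\sigma_{q,x}$ and $d_{q,x}$ act on the first variable: $\sigma_{q,x}(y)(x,\epsilon)=y(qx,\epsilon)$ and $d_{q,x}(y)(x,\epsilon)=\dfrac{y(qx,\epsilon)-y(x,\epsilon)}{qx-x}$. On formal power series they act term by term, by $\sigma_{q,x}(x^n)=q^nx^n$ and $d_{q,x}(x^n)=[n]_qx^{n-1}$, where $[n]_q=\frac{q^n-1}{q-1}$ (so $d_{q,x}(1)=0$). They act componentwise on vectors. A formal solution is a series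 $\hat y\in\mathbb{C}[[x,\epsilon]]^N$ with zero constant term (so that the composition $F(x,\epsilon,\hat y)$ with the Taylor expansion of $F$ at the origin is a well-defined formal power series) satisfying the system identically in $\mathbb{C}[[x,\epsilon]]^N$. *)

theory Defs
  imports "HOL-Analysis.Analysis" "HOL-Library.Groups_Big_Fun"
begin

text \<open>The library's \<^const>\<open>infnorm\<close> on \<^typ>\<open>complex ^ 'n\<close> takes real and imaginary parts separately, so it
  is not the maximum norm of a complex vector.\<close>

definition maxnorm :: "complex ^ 'n::finite \<Rightarrow> real" where
  "maxnorm v = Max (range (\<lambda>i. cmod (v $ i)))"

text \<open>An index \<open>(i, j, k)\<close> stands for the monomial \<open>x\<^sup>i \<epsilon>\<^sup>j y\<^sup>k\<close>, with \<open>k\<close> a multi-index.\<close>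

definition power_series_at ::
  "(complex \<times> complex \<times> (complex ^ 'n) \<Rightarrow> complex ^ 'n) \<Rightarrow> complex \<times> complex \<times> (complex ^ 'n) \<Rightarrow>
   (nat \<times> nat \<times> ('n::finite \<Rightarrow> nat) \<Rightarrow> complex ^ 'n) \<Rightarrow> bool" where
  "power_series_at F a c \<longleftrightarrow>
     (case a of (x0, e0, y0) \<Rightarrow>
       \<forall>\<^sub>F (x, e, y) in nhds a.
         ((\<lambda>(i, j, k). ((x - x0) ^ i * (e - e0) ^ j * (\<Prod>l\<in>UNIV. (y $ l - y0 $ l) ^ k l)) *s c (i, j, k))
            has_sum F (x, e, y)) UNIV)"

definition analytic_on3 ::
  "(complex \<times> complex \<times> (complex ^ 'n) \<Rightarrow> complex ^ 'n) \<Rightarrow> (complex \<times> complex \<times> (complex ^ 'n::finite)) set \<Rightarrow> bool" where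
  "analytic_on3 F U \<longleftrightarrow> (\<forall>a\<in>U. \<exists>c. power_series_at F a c)"

text \<open>The power series of an analytic function is unique, so the description below is proper
  whenever \<open>F\<close> is analytic at the origin.\<close>

definition taylor_coeff ::
  "(complex \<times> complex \<times> (complex ^ 'n) \<Rightarrow> complex ^ 'n) \<Rightarrow> nat \<times> nat \<times> ('n::finite \<Rightarrow> nat) \<Rightarrow> complex ^ 'n" where
  "taylor_coeff F = (THE c. power_series_at F (0, 0, 0) c)"

definition jacobian_y :: "(complex \<times> complex \<times> (complex ^ 'n) \<Rightarrow> complex ^ 'n) \<Rightarrow> complex ^ 'n ^ 'n::finite" where
  "jacobian_y F = (\<chi> i j. deriv (\<lambda>t. F (0, 0, axis j t) $ i) 0)"

text \<open>The ring \<open>\<complex>[[x, \<epsilon>]]\<close> is rendered as \<^typ>\<open>complex fps fps\<close>: the outer variable is \<open>x\<close>, the inner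
  one is \<open>\<epsilon>\<close>, and the coefficient of \<open>x\<^sup>m \<epsilon>\<^sup>n\<close> in \<open>f\<close> is \<^term>\<open>fps_nth (fps_nth f m) n\<close>.\<close>

definition X :: "complex fps fps" where
  "X = fps_X"

definition Eps :: "complex fps fps" where
  "Eps = fps_const fps_X"

definition sigma_q :: "complex \<Rightarrow> complex fps fps \<Rightarrow> complex fps fps" where
  "sigma_q q f = Abs_fps (\<lambda>n. fps_const (q ^ n) * fps_nth f n)"

definition q_number :: "complex \<Rightarrow> nat \<Rightarrow> complex" where
  "q_number q n = (q ^ n - 1) / (q - 1)"

definition d_q :: "complex \<Rightarrow> complex fps fps \<Rightarrow> complex fps fps" where
  "d_q q f = Abs_fps (\<lambda>n. fps_const (q_number q (Suc n)) * fps_nth f (Suc n))"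

definition x_coeff :: "(complex fps fps) ^ 'n::finite \<Rightarrow> nat \<Rightarrow> (complex fps) ^ 'n" where
  "x_coeff y n = (\<chi> i. fps_nth (y $ i) n)"

definition eps_coeff :: "(complex fps fps) ^ 'n::finite \<Rightarrow> nat \<Rightarrow> (complex fps) ^ 'n" where
  "eps_coeff y n = (\<chi> i. Abs_fps (\<lambda>m. fps_nth (fps_nth (y $ i) m) n))"

definition zero_constant_term :: "(complex fps fps) ^ 'n::finite \<Rightarrow> bool" where
  "zero_constant_term y \<longleftrightarrow> (\<forall>i. fps_nth (fps_nth (y $ i) 0) 0 = 0)"

text \<open>The formal composition \<open>F(x, \<epsilon>, y)\<close> is \<open>\<Sum> c\<^sub>i\<^sub>j\<^sub>k x\<^sup>i \<epsilon>\<^sup>j y\<^sup>k\<close>, with \<open>c\<close> the Taylor coefficients of \<open>F\<close>,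
  summed coefficient by coefficient. If \<open>y\<close> has zero constant term, then only the finitely many
  indices with \<open>i + j + |k| \<le> m + n\<close> contribute to the coefficient of \<open>x\<^sup>m \<epsilon>\<^sup>n\<close>, so that
  \<^const>\<open>Sum_any\<close> is the honest sum.\<close>

definition formal_compose ::
  "(complex \<times> complex \<times> (complex ^ 'n) \<Rightarrow> complex ^ 'n) \<Rightarrow> (complex fps fps) ^ 'n \<Rightarrow> (complex fps fps) ^ 'n::finite" where
  "formal_compose F y = (\<chi> h. Abs_fps (\<lambda>m. Abs_fps (\<lambda>n.
     Sum_any (\<lambda>(i, j, k). taylor_coeff F (i, j, k) $ h *
       fps_nth (fps_nth (X ^ i * Eps ^ j * (\<Prod>l\<in>UNIV. (y $ l) ^ k l)) m) n))))"

definition formal_solution_d ::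
  "complex \<Rightarrow> nat \<Rightarrow> nat \<Rightarrow> (complex \<times> complex \<times> (complex ^ 'n) \<Rightarrow> complex ^ 'n) \<Rightarrow> (complex fps fps) ^ 'n::finite \<Rightarrow> bool" where
  "formal_solution_d q p \<alpha> F y \<longleftrightarrow>
     zero_constant_term y \<and> (\<chi> i. Eps ^ \<alpha> * X ^ (p + 1) * d_q q (y $ i)) = formal_compose F y"

definition formal_solution_sigma ::
  "complex \<Rightarrow> nat \<Rightarrow> nat \<Rightarrow> (complex \<times> complex \<times> (complex ^ 'n) \<Rightarrow> complex ^ 'n) \<Rightarrow> (complex fps fps) ^ 'n::finite \<Rightarrow> bool" where
  "formal_solution_sigma q p \<alpha> F y \<longleftrightarrow>
     zero_constant_term y \<and> (\<chi> i. Eps ^ \<alpha> * X ^ p * sigma_q q (y $ i)) = formal_compose F y"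

definition Ob :: "real \<Rightarrow> complex fps set" where
  "Ob R = {f. (\<forall>z\<in>ball 0 R. summable (\<lambda>n. fps_nth f n * z ^ n)) \<and>
              eval_fps f holomorphic_on ball 0 R \<and> bounded (eval_fps f ` ball 0 R)}"

definition disc_sup :: "real \<Rightarrow> (complex fps) ^ 'n::finite \<Rightarrow> real" where
  "disc_sup R v = (SUP z\<in>ball 0 R. maxnorm (\<chi> i. eval_fps (v $ i) z))"

end

theory Submission
  imports Defs
begin

text \<open>
Write \<open>Q = |q| > 1\<close>, and let \<open>J\<close> be the Jacobian of \<open>F\<close> in \<open>y\<close> at the origin. Both systems have
the form \<open>L y = F(x, \<epsilon>, y)\<close>, where \<open>L\<close> sends \<open>x\<^sup>m \<epsilon>\<^sup>n\<close> to
\<open>\<lambda>\<^sub>m x\<^bsup>m + p\<^esup> \<epsilon>\<^bsup>n + \<alpha>\<^esup>\<close>, with \<open>\<lambda>\<^sub>m = q\<^sup>m\<close> or \<open>\<lambda>\<^sub>m = [m]\<^sub>q\<close>; in both cases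
\<open>|\<lambda>\<^sub>m| \<le> \<Lambda> Q\<^sup>m\<close>. Splitting off the part of \<open>F\<close> that is linear in \<open>y\<close>, the system becomes the fixed
point equation \<open>y = J\<^sup>-\<^sup>1 (L y - G y)\<close>, where \<open>G\<close> collects the monomials \<open>x\<^sup>i \<epsilon>\<^sup>j y\<^sup>k\<close> with
\<open>i + j \<ge> 1\<close> or \<open>|k| \<ge> 2\<close>. Since \<open>\<alpha> > 0\<close>, the coefficients of total degree \<open>N\<close> on the right depend
only on those of \<open>y\<close> of degree below \<open>N\<close> (\<open>fp_map_contracts\<close>), so that there is exactly one formal
solution, the limit of the iterates that start at \<open>0\<close>.

For the estimates, measure a series by \<open>\<Sum> |y\<^sub>m\<^sub>n| v(m, n)\<close> with the weight
\<open>v(m, n) = s\<^bsup>m + n\<^esup> Q\<^bsup>- w(m, n)\<^esup>\<close>. If the exponent \<open>w \<ge> 0\<close> is superadditive, these sums are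
submultiplicative. If moreover \<open>w(m + p, n + \<alpha>) \<ge> w(m, n) + m\<close>, then the weight absorbs the factors
\<open>\<lambda>\<^sub>m\<close>, and \<open>L\<close> has norm at most \<open>\<Lambda> s\<close>. As \<open>G\<close> has no constant and no linear terms in \<open>y\<close>
other than those with a factor \<open>x\<close> or \<open>\<epsilon>\<close>, for small \<open>d\<close> and much smaller \<open>s\<close> the right-hand side
maps the ball of radius \<open>d\<close> into itself. All iterates, and hence the solution, stay in that ball
(\<open>wnorm_limit_le\<close>). The choice of \<open>s\<close> and \<open>d\<close> is the same for all \<open>w\<close>
(\<open>unique_solution_weighted_bound\<close>).

Two exponents give everything. With \<open>w(m, n) = m\<^sup>2 / (2 p)\<close>, the coefficients of a fixed power
\<open>x\<^sup>m\<close> satisfy \<open>\<Sum>\<^sub>n |y\<^sub>m\<^sub>n| s\<^sup>n \<le> d s\<^bsup>-m\<^esup> Q\<^bsup>m\<^sup>2/(2p)\<^esup>\<close>, which is the bound on \<open>y\<^sub>m\<close> for \<open>p > 0\<close>.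
With \<open>w(m, n) = m \<lfloor>n / \<alpha>\<rfloor>\<close>, the factor \<open>Q\<^bsup>- w(m, n)\<^esup>\<close> is a power with exponent \<open>m\<close>, and shrinks the
radius in \<open>x\<close> for a fixed \<open>n\<close> to \<open>s / Q\<^bsup>\<lfloor>n/\<alpha>\<rfloor>\<^esup>\<close>; because \<open>\<lfloor>n / \<alpha>\<rfloor> \<le> n / \<alpha>\<close>, it also bounds
\<open>y\<^sub>m\<close> on the disc of radius \<open>s / Q\<^bsup>m/\<alpha>\<^esup>\<close>, which is the case \<open>p = 0\<close>.
\<close>

section \<open>Taylor coefficients of an analytic map\<close>

text \<open>Summing over the remaining indices first leaves a power series in one variable that vanishes near
  \<open>0\<close>. This separates one variable of a multiple power series from the others.\<close>

lemma has_sum_zero_power_series_coeff: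
  fixes g :: "nat \<Rightarrow> 'b \<Rightarrow> complex"
  assumes \<rho>: "\<rho> > 0"
    and sum: "\<And>t. cmod t < \<rho> \<Longrightarrow> ((\<lambda>(n, b). t ^ n * g n b) has_sum 0) (UNIV \<times> B)"
  shows "(g n has_sum 0) B"
proof -
  define t0 :: complex where "t0 = of_real (\<rho> / 2)"
  have t0: "cmod t0 < \<rho>" "t0 \<noteq> 0" using \<rho> by (auto simp: t0_def)
  have "(\<lambda>b. t0 ^ n * g n b) summable_on B" for n
    using summable_on_SigmaD1[OF has_sum_imp_summable[OF sum[OF t0(1)]], of n] by simp
  then have summ: "g n summable_on B" for n
    using t0(2) by (simp add: summable_on_cmult_right')
  define G where "G n = infsum (g n) B" for n
  have G: "(g n has_sum G n) B" for n
    using summ[of n] by (simp add: G_def)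
  have S: "(\<lambda>n. G n * t ^ n) sums 0" if "cmod t < \<rho>" for t
  proof -
    have "((\<lambda>n. t ^ n * G n) has_sum 0) UNIV"
      by (rule has_sum_SigmaD[OF sum[OF that]])
        (auto intro!: has_sum_cmult_right G)
    from has_sum_imp_sums[OF this] show ?thesis by (simp add: mult.commute)
  qed
  define f where "f = Abs_fps G"
  have "fps_conv_radius f \<ge> norm t0"
    unfolding fps_conv_radius_def
    by (rule conv_radius_geI) (use S[OF t0(1)] in \<open>simp add: f_def sums_iff\<close>)
  moreover have "norm t0 > 0" using t0 by simp
  ultimately have "fps_conv_radius f > 0"
    using less_le_trans[of 0 "ereal (norm t0)"] by simp
  moreover have "\<forall>\<^sub>F z in nhds 0. eval_fps f z = eval_fps 0 z"
  proof (rule eventually_mono)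
    show "\<forall>\<^sub>F z in nhds (0::complex). z \<in> ball 0 \<rho>"
      by (rule eventually_nhds_in_open) (use \<rho> in auto)
    fix z :: complex assume "z \<in> ball 0 \<rho>"
    then show "eval_fps f z = eval_fps 0 z"
      using S[of z] by (simp add: eval_fps_def f_def sums_iff)
  qed
  ultimately have "f = 0" by (intro eval_fps_eqD) auto
  then have "G n = 0" by (metis f_def fps_nth_Abs_fps fps_zero_nth)
  with G[of n] show ?thesis by simp
qed

text \<open>The variables in \<open>S\<close> are separated one at a time.\<close>

lemma multivariate_power_series_zero:
  fixes d :: "('v \<Rightarrow> nat) \<Rightarrow> complex"
  assumes "finite S" and \<rho>: "\<rho> > 0"
    and "\<And>z. (\<And>l. cmod (z l) < \<rho>) \<Longrightarrow>
      ((\<lambda>k. (\<Prod>l\<in>S. z l ^ k l) * d k) has_sum 0) {k. \<forall>l. l \<notin> S \<longrightarrow> k l = 0}"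
    and "\<forall>l. l \<notin> S \<longrightarrow> k l = 0"
  shows "d k = 0"
  using assms(1,3,4)
proof (induction S arbitrary: d k rule: finite_induct)
  case empty
  have "{k::'v \<Rightarrow> nat. \<forall>l. l \<notin> {} \<longrightarrow> k l = 0} = {\<lambda>_. 0}" by auto
  moreover have "k = (\<lambda>_. 0)" using empty by auto
  ultimately show ?case
    using empty(1)[of "\<lambda>_. 0"] \<rho> by (simp add: has_sum_finite_iff)
next
  case (insert v S)
  define B where "B = {k::'v \<Rightarrow> nat. \<forall>l. l \<notin> S \<longrightarrow> k l = 0}"
  define g where "g z n k = (\<Prod>l\<in>S. z l ^ k l) * d (k(v := n))" for z :: "'v \<Rightarrow> complex" and n k
  have bij: "bij_betw (\<lambda>(n, k). k(v := n)) (UNIV \<times> B) {k. \<forall>l. l \<notin> insert v S \<longrightarrow> k l = 0}"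
    by (rule bij_betw_byWitness[where f' = "\<lambda>k. (k v, k(v := 0))"])
      (use insert.hyps in \<open>auto simp: B_def fun_eq_iff\<close>)
  have "((\<lambda>(n, k). t ^ n * g z n k) has_sum 0) (UNIV \<times> B)"
    if z: "\<And>l. cmod (z l) < \<rho>" and t: "cmod t < \<rho>" for z t
  proof -
    have "((\<lambda>k. (\<Prod>l\<in>insert v S. (z(v := t)) l ^ k l) * d k) has_sum 0)
        {k. \<forall>l. l \<notin> insert v S \<longrightarrow> k l = 0}"
      by (rule insert.prems(1)) (use z t in auto)
    then have "((\<lambda>x. (\<lambda>k. (\<Prod>l\<in>insert v S. (z(v := t)) l ^ k l) * d k) ((\<lambda>(n, k). k(v := n)) x))
        has_sum 0) (UNIV \<times> B)"
      by (subst has_sum_reindex_bij_betw[OF bij])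
    moreover have "(\<Prod>l\<in>insert v S. (z(v := t)) l ^ (k(v := n)) l) = t ^ n * (\<Prod>l\<in>S. z l ^ k l)" for n k
    proof -
      have "(\<Prod>l\<in>S. (z(v := t)) l ^ (k(v := n)) l) = (\<Prod>l\<in>S. z l ^ k l)"
        by (rule prod.cong) (use insert.hyps in auto)
      then show ?thesis using insert.hyps by simp
    qed
    ultimately show ?thesis
      by (simp add: g_def case_prod_unfold mult.assoc)
  qed
  then have "(g z n has_sum 0) B" if "\<And>l. cmod (z l) < \<rho>" for z n
    using has_sum_zero_power_series_coeff[OF \<rho>] that by blast
  then have "d ((k(v := 0))(v := k v)) = 0"
    by (intro insert.IH[of "\<lambda>k'. d (k'(v := k v))" "k(v := 0)"])
      (use insert.prems(2) in \<open>auto simp: g_def[abs_def] B_def\<close>)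
  then show ?case by simp
qed

lemma eventually_nhds_0_polydisc:
  fixes P :: "complex \<times> complex \<times> (complex ^ 'n::finite) \<Rightarrow> bool"
  assumes "\<forall>\<^sub>F z in nhds (0, 0, 0). P z"
  shows "\<exists>\<rho>>0. \<forall>x e y. cmod x < \<rho> \<longrightarrow> cmod e < \<rho> \<longrightarrow> (\<forall>l. cmod (y $ l) < \<rho>) \<longrightarrow> P (x, e, y)"
proof -
  from assms obtain d where d: "d > 0" "\<And>z. dist z (0, 0, 0) < d \<Longrightarrow> P z"
    by (auto simp: eventually_nhds_metric)
  \<comment> \<open>one coordinate each for \<open>x\<close> and \<open>\<epsilon>\<close>, and the components of \<open>y\<close> in the \<open>\<ell>\<^sup>1\<close> norm\<close>
  define M where "M = 2 + real (CARD('n))"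
  define \<rho> where "\<rho> = d / M"
  have M: "M > 0" by (simp add: M_def)
  show ?thesis
  proof (intro exI[of _ \<rho>] conjI allI impI)
    show "\<rho> > 0" using d M by (simp add: \<rho>_def)
    fix x e :: complex and y :: "complex ^ 'n"
    assume x: "cmod x < \<rho>" and e: "cmod e < \<rho>" and y: "\<forall>l. cmod (y $ l) < \<rho>"
    have "norm (x, e, y) \<le> norm x + norm (e, y)" by (rule norm_Pair_le)
    also have "\<dots> \<le> norm x + (norm e + norm y)" using norm_Pair_le[of e y] by simp
    also have "norm y \<le> (\<Sum>l\<in>UNIV. cmod (y $ l))"
      unfolding norm_vec_def by (rule L2_set_le_sum) auto
    also have "\<dots> \<le> real (CARD('n)) * \<rho>"
      by (rule sum_bounded_above[where A = UNIV, simplified]) (use y in \<open>auto intro: less_imp_le\<close>)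
    also have "norm x + (norm e + real (CARD('n)) * \<rho>) < M * \<rho>"
      using x e by (simp add: M_def algebra_simps)
    also have "M * \<rho> = d" using M by (simp add: \<rho>_def)
    finally have "norm (x, e, y) < d" by simp
    then show "P (x, e, y)"
      by (intro d(2)) (simp add: dist_norm)
  qed
qed

text \<open>The components are taken separately and the product is nested to the right, so that \<open>x\<close>, \<open>\<epsilon>\<close> and
  the components of \<open>y\<close> can be separated in this order.\<close>

definition expands_on ::
  "(complex \<times> complex \<times> (complex ^ 'n) \<Rightarrow> complex ^ 'n) \<Rightarrow>
   (nat \<times> nat \<times> ('n::finite \<Rightarrow> nat) \<Rightarrow> complex ^ 'n) \<Rightarrow> real \<Rightarrow> bool" where
  "expands_on F c \<rho> \<longleftrightarrow> (\<forall>x e y h. cmod x < \<rho> \<longrightarrow> cmod e < \<rho> \<longrightarrow> (\<forall>l. cmod (y $ l) < \<rho>) \<longrightarrow>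
     ((\<lambda>(i, j, k). x ^ i * (e ^ j * ((\<Prod>l\<in>UNIV. y $ l ^ k l) * c (i, j, k) $ h)))
        has_sum F (x, e, y) $ h) UNIV)"

lemma expands_onD:
  assumes "expands_on F c \<rho>" "cmod x < \<rho>" "cmod e < \<rho>" "\<And>l. cmod (y $ l) < \<rho>"
  shows "((\<lambda>(i, j, k). x ^ i * (e ^ j * ((\<Prod>l\<in>UNIV. y $ l ^ k l) * c (i, j, k) $ h)))
    has_sum F (x, e, y) $ h) UNIV"
  using assms by (auto simp: expands_on_def)

lemma power_series_at_imp_expands_on:
  fixes F :: "complex \<times> complex \<times> (complex ^ 'n) \<Rightarrow> complex ^ 'n::finite"
  assumes "power_series_at F (0, 0, 0) c"
  shows "\<exists>\<rho>>0. expands_on F c \<rho>"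
proof -
  have "\<forall>\<^sub>F z in nhds (0, 0, 0). case z of (x, e, y) \<Rightarrow>
      ((\<lambda>(i, j, k). (x ^ i * e ^ j * (\<Prod>l\<in>UNIV. y $ l ^ k l)) *s c (i, j, k)) has_sum F (x, e, y)) UNIV"
    using assms by (simp add: power_series_at_def)
  then obtain \<rho> where \<rho>: "\<rho> > 0" "\<And>x e y. cmod x < \<rho> \<Longrightarrow> cmod e < \<rho> \<Longrightarrow> (\<And>l. cmod (y $ l) < \<rho>) \<Longrightarrow>
      (case (x, e, y) of (x, e, y) \<Rightarrow>
        ((\<lambda>(i, j, k). (x ^ i * e ^ j * (\<Prod>l\<in>UNIV. y $ l ^ k l)) *s c (i, j, k)) has_sum F (x, e, y)) UNIV)"
    using eventually_nhds_0_polydisc[of "\<lambda>z. case z of (x, e, y) \<Rightarrow>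
      ((\<lambda>(i, j, k). (x ^ i * e ^ j * (\<Prod>l\<in>UNIV. y $ l ^ k l)) *s c (i, j, k)) has_sum F (x, e, y)) UNIV"]
    by blast
  have "expands_on F c \<rho>"
    unfolding expands_on_def
  proof (intro allI impI)
    fix x e :: complex and y :: "complex ^ 'n" and h
    assume "cmod x < \<rho>" "cmod e < \<rho>" "\<forall>l. cmod (y $ l) < \<rho>"
    then have "((\<lambda>(i, j, k). (x ^ i * e ^ j * (\<Prod>l\<in>UNIV. y $ l ^ k l)) *s c (i, j, k)) has_sum F (x, e, y)) UNIV"
      using \<rho>(2)[of x e y] by simp
    from has_sum_bounded_linear[OF bounded_linear_vec_nth this, of h]
    show "((\<lambda>(i, j, k). x ^ i * (e ^ j * ((\<Prod>l\<in>UNIV. y $ l ^ k l) * c (i, j, k) $ h)))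
        has_sum F (x, e, y) $ h) UNIV"
      by (simp add: case_prod_unfold mult.assoc)
  qed
  with \<rho>(1) show ?thesis by blast
qed

lemma power_series_at_unique:
  fixes F :: "complex \<times> complex \<times> (complex ^ 'n) \<Rightarrow> complex ^ 'n::finite"
  assumes c: "power_series_at F (0, 0, 0) c" and c': "power_series_at F (0, 0, 0) c'"
  shows "c = c'"
proof -
  obtain \<rho>1 where r10: "\<rho>1 > 0" "expands_on F c \<rho>1"
    using power_series_at_imp_expands_on[OF c] by blast
  note r1 = r10(1) expands_onD[OF r10(2)]
  obtain \<rho>2 where r20: "\<rho>2 > 0" "expands_on F c' \<rho>2"
    using power_series_at_imp_expands_on[OF c'] by blast
  note r2 = r20(1) expands_onD[OF r20(2)]
  define \<rho> where "\<rho> = min \<rho>1 \<rho>2"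
  have \<rho>: "\<rho> > 0" using r1 r2 by (simp add: \<rho>_def)
  show ?thesis
  proof (rule ext)
    fix idx :: "nat \<times> nat \<times> ('n \<Rightarrow> nat)"
    obtain i0 j0 k0 where idx: "idx = (i0, j0, k0)" by (cases idx)
    have "c (i0, j0, k0) $ h - c' (i0, j0, k0) $ h = 0" for h
    proof -
      define d where "d i j k = c (i, j, k) $ h - c' (i, j, k) $ h" for i j k
      have "((\<lambda>(i, j, k). x ^ i * (e ^ j * ((\<Prod>l\<in>UNIV. z l ^ k l) * d i j k))) has_sum 0) (UNIV \<times> UNIV)"
        if "cmod x < \<rho>" "cmod e < \<rho>" "\<And>l. cmod (z l) < \<rho>" for x e z
      proof -
        have "((\<lambda>(i, j, k). x ^ i * (e ^ j * ((\<Prod>l\<in>UNIV. (\<chi> l. z l) $ l ^ k l) * c (i, j, k) $ h)))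
            has_sum F (x, e, \<chi> l. z l) $ h) UNIV"
          "((\<lambda>(i, j, k). - 1 * (x ^ i * (e ^ j * ((\<Prod>l\<in>UNIV. (\<chi> l. z l) $ l ^ k l) * c' (i, j, k) $ h))))
            has_sum (- 1) * (F (x, e, \<chi> l. z l) $ h)) UNIV"
          using r1(2)[of x e "\<chi> l. z l" h] has_sum_cmult_right[OF r2(2)[of x e "\<chi> l. z l" h], of "- 1"] that
          by (simp_all add: \<rho>_def case_prod_unfold)
        from has_sum_add[OF this] show ?thesis
          by (simp add: case_prod_unfold d_def algebra_simps)
      qed
      then have "((\<lambda>jk. case jk of (j, k) \<Rightarrow> e ^ j * ((\<Prod>l\<in>UNIV. z l ^ k l) * d i0 j k)) has_sum 0) (UNIV \<times> UNIV)"
        if "cmod e < \<rho>" "\<And>l. cmod (z l) < \<rho>" for e z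
        using that
          has_sum_zero_power_series_coeff[OF \<rho>, of "\<lambda>i (j, k). e ^ j * ((\<Prod>l\<in>UNIV. z l ^ k l) * d i j k)" UNIV]
        by (simp add: case_prod_unfold)
      then have "((\<lambda>k. (\<Prod>l\<in>UNIV. z l ^ k l) * d i0 j0 k) has_sum 0) UNIV"
        if "\<And>l. cmod (z l) < \<rho>" for z
        using that
        by (intro has_sum_zero_power_series_coeff[OF \<rho>, of "\<lambda>j k. (\<Prod>l\<in>UNIV. z l ^ k l) * d i0 j k" UNIV])
          (simp add: case_prod_unfold)
      then have "d i0 j0 k0 = 0"
        by (intro multivariate_power_series_zero[of UNIV \<rho> "d i0 j0" k0]) (use \<rho> in auto)
      then show ?thesis by (simp add: d_def)
    qed
    then show "c idx = c' idx" by (simp add: vec_eq_iff idx)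
  qed
qed

lemma taylor_coeff_eqI:
  assumes "power_series_at F (0, 0, 0) c"
  shows "taylor_coeff F = c"
  unfolding taylor_coeff_def
  by (rule the_equality) (use assms power_series_at_unique in blast)+

definition index_degree :: "nat \<times> nat \<times> ('n::finite \<Rightarrow> nat) \<Rightarrow> nat" where
  "index_degree = (\<lambda>(i, j, k). i + j + sum k UNIV)"

lemma index_degree_simp [simp]: "index_degree (i, j, k) = i + j + sum k UNIV"
  by (simp add: index_degree_def)

definition unit_index :: "'n::finite \<Rightarrow> 'n \<Rightarrow> nat" where
  "unit_index l = (\<lambda>_. 0)(l := 1)"

text \<open>The expansion converges absolutely at the point with all coordinates \<open>\<rho>\<close>. The sum there, rather
  than a Cauchy bound on single coefficients, is what the contraction estimate uses.\<close>

lemma taylor_coeff_abs_summable: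
  fixes F :: "complex \<times> complex \<times> (complex ^ 'n) \<Rightarrow> complex ^ 'n::finite"
  assumes "power_series_at F (0, 0, 0) c"
  obtains \<rho> K where "\<rho> > 0" "K > 0"
    "\<And>I h. finite I \<Longrightarrow> (\<Sum>a\<in>I. cmod (c a $ h) * \<rho> ^ index_degree a) \<le> K"
proof -
  obtain r where r0: "r > 0" "expands_on F c r"
    using power_series_at_imp_expands_on[OF assms] by blast
  note r = r0(1) expands_onD[OF r0(2)]
  define \<rho> where "\<rho> = r / 2"
  have \<rho>: "\<rho> > 0" "\<rho> < r" using r by (auto simp: \<rho>_def)
  define K where "K h = (\<Sum>\<^sub>\<infinity>a. cmod (c a $ h) * \<rho> ^ index_degree a)" for h
  have bound: "(\<Sum>a\<in>I. cmod (c a $ h) * \<rho> ^ index_degree a) \<le> K h" if "finite I" for I h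
  proof -
    let ?f = "\<lambda>(i, j, k). of_real \<rho> ^ i * (of_real \<rho> ^ j * ((\<Prod>l\<in>UNIV. (\<chi> l. of_real \<rho>) $ l ^ k l) * c (i, j, k) $ h))"
    have "?f summable_on UNIV"
      by (rule has_sum_imp_summable, rule r(2)) (use \<rho> in auto)
    then have "(\<lambda>a. cmod (?f a)) summable_on UNIV"
      by (simp add: summable_on_iff_abs_summable_on_complex)
    moreover have "cmod (?f a) = cmod (c a $ h) * \<rho> ^ index_degree a" for a
      using \<rho> by (auto simp: case_prod_unfold norm_mult norm_power power_add power_sum index_degree_def prod_norm[symmetric])
    ultimately have "(\<lambda>a. cmod (c a $ h) * \<rho> ^ index_degree a) summable_on UNIV" by simp
    then show ?thesis
      unfolding K_def by (intro finite_sum_le_infsum) (use that \<rho> in auto)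
  qed
  have K0: "K h \<ge> 0" for h using bound[of "{}" h] by simp
  show ?thesis
  proof (rule that[OF \<rho>(1)])
    show "1 + (\<Sum>h\<in>UNIV. K h) > 0" using K0 by (simp add: add_pos_nonneg sum_nonneg)
    fix I :: "(nat \<times> nat \<times> ('n \<Rightarrow> nat)) set" and h assume I: "finite I"
    have "K h \<le> (\<Sum>h\<in>UNIV. K h)" by (rule member_le_sum) (use K0 in auto)
    with bound[OF I, of h] show "(\<Sum>a\<in>I. cmod (c a $ h) * \<rho> ^ index_degree a) \<le> 1 + (\<Sum>h\<in>UNIV. K h)"
      by simp
  qed
qed

lemma power_series_constant_term:
  fixes F :: "complex \<times> complex \<times> (complex ^ 'n) \<Rightarrow> complex ^ 'n::finite"
  assumes "power_series_at F (0, 0, 0) c"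
  shows "c (0, 0, (\<lambda>_. 0)) = F (0, 0, 0)"
proof -
  obtain r where r0: "r > 0" "expands_on F c r"
    using power_series_at_imp_expands_on[OF assms] by blast
  note r = r0(1) expands_onD[OF r0(2)]
  have "c (0, 0, (\<lambda>_. 0)) $ h = F (0, 0, 0) $ h" for h
  proof -
    let ?f = "\<lambda>(i, j, k). 0 ^ i * (0 ^ j * ((\<Prod>l\<in>UNIV. (0 :: complex ^ 'n) $ l ^ k l) * c (i, j, k) $ h))"
    have "(?f has_sum F (0, 0, 0) $ h) UNIV"
      by (rule r(2)) (use r(1) in auto)
    also have "?this \<longleftrightarrow> (?f has_sum F (0, 0, 0) $ h) {(0, 0, \<lambda>_. 0)}"
    proof (rule has_sum_cong_neutral)
      fix a :: "nat \<times> nat \<times> ('n \<Rightarrow> nat)" assume "a \<in> UNIV - {(0, 0, \<lambda>_. 0)}"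
      then show "?f a = 0" by (cases a) (auto simp: fun_eq_iff)
    qed auto
    finally show ?thesis by (simp add: has_sum_finite_iff)
  qed
  then show ?thesis by (simp add: vec_eq_iff)
qed

text \<open>On the axis \<open>t \<mapsto> (0, 0, t e\<^sub>l)\<close> only the powers of \<open>y\<^sub>l\<close> survive, and the derivative at \<open>0\<close> is the
  coefficient of \<open>t\<close>.\<close>

lemma jacobian_y_taylor:
  fixes F :: "complex \<times> complex \<times> (complex ^ 'n) \<Rightarrow> complex ^ 'n::finite"
  assumes "power_series_at F (0, 0, 0) c"
  shows "jacobian_y F $ h $ l = c (0, 0, unit_index l) $ h"
proof -
  obtain r where r0: "r > 0" "expands_on F c r"
    using power_series_at_imp_expands_on[OF assms] by blast
  note r = r0(1) expands_onD[OF r0(2)]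
  define idx where "idx n = (0::nat, 0::nat, (\<lambda>_. 0)(l := n))" for n :: nat
  define f where "f = Abs_fps (\<lambda>n. c (idx n) $ h)"
  have S: "(\<lambda>n. c (idx n) $ h * t ^ n) sums (F (0, 0, axis l t) $ h)" if t: "cmod t < r" for t
  proof -
    let ?f = "\<lambda>(i, j, k). 0 ^ i * (0 ^ j * ((\<Prod>l'\<in>UNIV. axis l t $ l' ^ k l') * c (i, j, k) $ h))"
    have prod: "(\<Prod>l'\<in>UNIV. axis l t $ l' ^ k l') = t ^ k l" if "\<And>l'. l' \<noteq> l \<Longrightarrow> k l' = 0" for k
    proof -
      have "(\<Prod>l'\<in>UNIV. axis l t $ l' ^ k l') = (\<Prod>l'\<in>UNIV. if l' = l then t ^ k l else 1)"
        by (rule prod.cong) (use that in \<open>auto simp: axis_def\<close>)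
      then show ?thesis by simp
    qed
    have "(?f has_sum F (0, 0, axis l t) $ h) UNIV"
      by (rule r(2)) (use r(1) t in \<open>auto simp: axis_def\<close>)
    also have "?this \<longleftrightarrow> (?f has_sum F (0, 0, axis l t) $ h) (range idx)"
    proof (rule has_sum_cong_neutral)
      fix a :: "nat \<times> nat \<times> ('n \<Rightarrow> nat)" assume a: "a \<in> UNIV - range idx"
      obtain i j k where ijk: "a = (i, j, k)" by (cases a)
      show "?f a = 0"
      proof (cases "i = 0 \<and> j = 0")
        case True
        have "\<exists>l'. l' \<noteq> l \<and> k l' \<noteq> 0"
        proof (rule ccontr)
          assume "\<not> ?thesis"
          then have "a = idx (k l)" using True by (auto simp: idx_def ijk fun_eq_iff)
          with a show False by auto
        qed
        then obtain l' where "l' \<noteq> l" "k l' \<noteq> 0" by blast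
        then have "(\<Prod>l'\<in>UNIV. axis l t $ l' ^ k l') = 0"
          by (intro prod_zero) (auto simp: axis_def intro!: bexI[of _ l'])
        then show ?thesis by (simp add: ijk)
      qed (auto simp: ijk)
    qed auto
    also have "\<dots> \<longleftrightarrow> ((?f \<circ> idx) has_sum F (0, 0, axis l t) $ h) UNIV"
    proof (rule has_sum_reindex)
      show "inj idx" by (rule inj_on_inverseI[of _ "\<lambda>(i, j, k). k l"]) (simp add: idx_def)
    qed
    also have "?f \<circ> idx = (\<lambda>n. c (idx n) $ h * t ^ n)"
      by (rule ext) (simp add: idx_def prod)
    finally show ?thesis by (rule has_sum_imp_sums)
  qed
  define t0 :: complex where "t0 = of_real (r / 2)"
  have t0: "cmod t0 < r" "cmod t0 > 0" using r(1) by (auto simp: t0_def)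
  have "fps_conv_radius f \<ge> norm t0"
    unfolding fps_conv_radius_def
    by (rule conv_radius_geI) (use S[OF t0(1)] in \<open>simp add: f_def sums_iff\<close>)
  then have "fps_conv_radius f > 0"
    using t0 less_le_trans[of 0 "ereal (norm t0)"] by simp
  then have "(eval_fps f has_field_derivative eval_fps (fps_deriv f) 0) (at 0)"
    by (intro has_field_derivative_eval_fps) (simp add: zero_ereal_def)
  moreover have "\<forall>\<^sub>F t in nhds 0. eval_fps f t = F (0, 0, axis l t) $ h"
  proof (rule eventually_mono)
    show "\<forall>\<^sub>F z in nhds (0::complex). z \<in> ball 0 r"
      by (rule eventually_nhds_in_open) (use r(1) in auto)
    fix t :: complex assume "t \<in> ball 0 r"
    then show "eval_fps f t = F (0, 0, axis l t) $ h"
      using S[of t] by (simp add: eval_fps_def f_def sums_iff)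
  qed
  ultimately have "((\<lambda>t. F (0, 0, axis l t) $ h) has_field_derivative eval_fps (fps_deriv f) 0) (at 0)"
    using DERIV_cong_ev[OF refl _ refl, of "eval_fps f" "\<lambda>t. F (0, 0, axis l t) $ h" 0] by blast
  then have "deriv (\<lambda>t. F (0, 0, axis l t) $ h) 0 = fps_nth f 1"
    by (simp add: DERIV_imp_deriv eval_fps_at_0)
  then show ?thesis
    by (simp add: jacobian_y_def f_def idx_def unit_index_def)
qed

section \<open>Order of a double power series\<close>

abbreviation coeff2 :: "complex fps fps \<Rightarrow> nat \<Rightarrow> nat \<Rightarrow> complex" where
  "coeff2 f m n \<equiv> fps_nth (fps_nth f m) n"

lemma coeff2_mult:
  "coeff2 (f * g) m n = (\<Sum>i=0..m. \<Sum>j=0..n. coeff2 f i j * coeff2 g (m - i) (n - j))"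
  by (simp add: fps_mult_nth fps_sum_nth)

lemma coeff2_scale [simp]: "coeff2 (fps_const (fps_const a) * f) m n = a * coeff2 f m n"
  by simp

lemma coeff2_X: "coeff2 X m n = (if (m, n) = (1, 0) then 1 else 0)"
  by (simp add: X_def)

lemma coeff2_Eps: "coeff2 Eps m n = (if (m, n) = (0, 1) then 1 else 0)"
  by (simp add: Eps_def)

lemma coeff2_1: "coeff2 1 m n = (if (m, n) = (0, 0) then 1 else 0)"
  by simp

definition order_ge :: "nat \<Rightarrow> complex fps fps \<Rightarrow> bool" where
  "order_ge N f \<longleftrightarrow> (\<forall>m n. m + n < N \<longrightarrow> coeff2 f m n = 0)"

lemma order_geD: "order_ge N f \<Longrightarrow> m + n < N \<Longrightarrow> coeff2 f m n = 0"
  by (simp add: order_ge_def)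

lemma order_ge_0 [simp]: "order_ge 0 f"
  by (simp add: order_ge_def)

lemma order_ge_zero [simp]: "order_ge N 0"
  by (simp add: order_ge_def)

lemma order_ge_mono: "order_ge N f \<Longrightarrow> M \<le> N \<Longrightarrow> order_ge M f"
  by (auto simp: order_ge_def)

lemma order_ge_add: "order_ge N f \<Longrightarrow> order_ge N g \<Longrightarrow> order_ge N (f + g)"
  by (simp add: order_ge_def)

lemma order_ge_diff: "order_ge N f \<Longrightarrow> order_ge N g \<Longrightarrow> order_ge N (f - g)"
  by (simp add: order_ge_def)

lemma order_ge_mult:
  assumes "order_ge M f" "order_ge N g"
  shows "order_ge (M + N) (f * g)"
  unfolding order_ge_def
proof (intro allI impI)
  fix m n assume mn: "m + n < M + N"
  have "coeff2 f i j * coeff2 g (m - i) (n - j) = 0" if "i \<le> m" "j \<le> n" for i j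
  proof (cases "i + j < M")
    case True
    then show ?thesis using order_geD[OF assms(1)] by simp
  next
    case False
    then have "(m - i) + (n - j) < N" using mn that by linarith
    then show ?thesis using order_geD[OF assms(2)] by simp
  qed
  then show "coeff2 (f * g) m n = 0"
    unfolding coeff2_mult by (intro sum.neutral ballI) auto
qed

lemma order_ge_power: "order_ge 1 f \<Longrightarrow> order_ge k (f ^ k)"
proof (induction k)
  case (Suc k)
  then show ?case using order_ge_mult[of 1 f k "f ^ k"] by simp
qed simp

lemma order_ge_prod_power:
  assumes "finite S" "\<And>l. l \<in> S \<Longrightarrow> order_ge 1 (f l)"
  shows "order_ge (sum k S) (\<Prod>l\<in>S. f l ^ k l)"
  using assms
proof (induction S rule: finite_induct)
  case (insert v S)
  then show ?case
    using order_ge_mult[OF order_ge_power[of "f v" "k v"], of "sum k S"] by simp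
qed simp

text \<open>In \<open>f\<^sup>k - g\<^sup>k\<close> the difference \<open>f - g\<close> is multiplied by \<open>k - 1\<close> factors without constant term. The
  order \<open>M + k\<close> for \<open>f - g\<close> of order \<open>M + 1\<close> expresses this without a truncated subtraction.\<close>

lemma order_ge_power_diff:
  assumes f: "order_ge 1 f" and g: "order_ge 1 g" and fg: "order_ge (Suc M) (f - g)"
  shows "order_ge (M + k) (f ^ k - g ^ k)"
proof (induction k)
  case (Suc k)
  have "f ^ Suc k - g ^ Suc k = f * (f ^ k - g ^ k) + (f - g) * g ^ k"
    by (simp add: algebra_simps)
  moreover have "order_ge (M + Suc k) (f * (f ^ k - g ^ k))"
    using order_ge_mult[OF f Suc.IH] by simp
  moreover have "order_ge (M + Suc k) ((f - g) * g ^ k)"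
    using order_ge_mult[OF fg order_ge_power[OF g, of k]] by simp
  ultimately show ?case by (simp only: order_ge_add)
qed simp

lemma order_ge_prod_power_diff:
  assumes "finite S" and f: "\<And>l. order_ge 1 (f l)" and g: "\<And>l. order_ge 1 (g l)"
    and fg: "\<And>l. order_ge (Suc M) (f l - g l)"
  shows "order_ge (M + sum k S) ((\<Prod>l\<in>S. f l ^ k l) - (\<Prod>l\<in>S. g l ^ k l))"
  using assms(1)
proof (induction S rule: finite_induct)
  case (insert v S)
  let ?P = "\<Prod>l\<in>S. f l ^ k l" and ?Q = "\<Prod>l\<in>S. g l ^ k l"
  have "(\<Prod>l\<in>insert v S. f l ^ k l) - (\<Prod>l\<in>insert v S. g l ^ k l)
      = f v ^ k v * (?P - ?Q) + (f v ^ k v - g v ^ k v) * ?Q"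
    using insert.hyps by (simp add: algebra_simps)
  moreover have "order_ge (M + sum k (insert v S)) (f v ^ k v * (?P - ?Q))"
    using order_ge_mult[OF order_ge_power[OF f[of v], of "k v"] insert.IH] insert.hyps
    by (simp add: ac_simps)
  moreover have "order_ge (M + sum k (insert v S)) ((f v ^ k v - g v ^ k v) * ?Q)"
    using order_ge_mult[OF order_ge_power_diff[OF f[of v] g[of v] fg[of v], of "k v"]
        order_ge_prod_power[OF insert.hyps(1), of g k]] g insert.hyps
    by (simp add: ac_simps)
  ultimately show ?case by (simp only: order_ge_add)
qed simp

definition monomial :: "nat \<times> nat \<times> ('n::finite \<Rightarrow> nat) \<Rightarrow> (complex fps fps) ^ 'n \<Rightarrow> complex fps fps" where
  "monomial = (\<lambda>(i, j, k) y. X ^ i * Eps ^ j * (\<Prod>l\<in>UNIV. (y $ l) ^ k l))"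

lemma order_ge_X: "order_ge 1 X" and order_ge_Eps: "order_ge 1 Eps"
  by (auto simp: order_ge_def coeff2_X coeff2_Eps)

lemma order_ge_monomial:
  assumes "\<And>l. order_ge 1 (y $ l)"
  shows "order_ge (index_degree a) (monomial a y)"
proof (cases a)
  case (fields i j k)
  have "order_ge (i + j + sum k UNIV) (X ^ i * Eps ^ j * (\<Prod>l\<in>UNIV. (y $ l) ^ k l))"
    by (intro order_ge_mult order_ge_power order_ge_X order_ge_Eps order_ge_prod_power) (use assms in auto)
  then show ?thesis by (simp add: monomial_def fields)
qed

text \<open>The truncation at degree \<open>N\<close> makes this a finite set that contains every index contributing in degrees
  up to \<open>N\<close>. The excluded indices are those of the constant term and of the terms \<open>c y\<^sub>l\<close>, which the
  fixed point equation keeps apart.\<close>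

definition higher_indices :: "nat \<Rightarrow> (nat \<times> nat \<times> ('n::finite \<Rightarrow> nat)) set" where
  "higher_indices N = {(i, j, k). i + j + sum k UNIV \<le> N \<and> (1 \<le> i + j \<or> 2 \<le> sum k UNIV)}"

lemma finite_index_degree_le: "finite {a. index_degree (a :: nat \<times> nat \<times> ('n::finite \<Rightarrow> nat)) \<le> N}"
proof (rule finite_subset)
  have "k l \<le> N" if "sum k UNIV \<le> N" for k :: "'n \<Rightarrow> nat" and l
    using member_le_sum[of l UNIV k] that by simp
  then show "{a. index_degree (a :: nat \<times> nat \<times> ('n \<Rightarrow> nat)) \<le> N}
      \<subseteq> {..N} \<times> {..N} \<times> (UNIV \<rightarrow>\<^sub>E {..N})"
    by (auto simp: PiE_def Pi_def)
  show "finite ({..N} \<times> {..N} \<times> ((UNIV :: 'n set) \<rightarrow>\<^sub>E {..N}))"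
    by (intro finite_cartesian_product finite_PiE) auto
qed

lemma finite_higher_indices [simp]: "finite (higher_indices N)"
  by (rule finite_subset[OF _ finite_index_degree_le[of N]]) (auto simp: higher_indices_def)

text \<open>A monomial with a factor \<open>x\<close> or \<open>\<epsilon>\<close>, or of degree at least two in \<open>y\<close>, gains one order on
  differences. This is why the formal solution is determined degree by degree.\<close>

lemma order_ge_monomial_diff:
  assumes a: "a \<in> higher_indices N"
    and y: "\<And>l. order_ge 1 (y $ l)" and z: "\<And>l. order_ge 1 (z $ l)"
    and yz: "\<And>l. order_ge (Suc M) (y $ l - z $ l)"
  shows "order_ge (Suc (Suc M)) (monomial a y - monomial a z)"
proof (cases a)
  case (fields i j k)
  have *: "monomial a y - monomial a z
      = X ^ i * Eps ^ j * ((\<Prod>l\<in>UNIV. (y $ l) ^ k l) - (\<Prod>l\<in>UNIV. (z $ l) ^ k l))"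
    by (simp add: monomial_def fields algebra_simps)
  have ord: "order_ge (i + j + (M + sum k UNIV)) (monomial a y - monomial a z)"
    unfolding *
    by (intro order_ge_mult order_ge_power order_ge_X order_ge_Eps order_ge_prod_power_diff y z yz) auto
  show ?thesis
  proof (cases "sum k UNIV = 0")
    case True
    then show ?thesis by (simp add: * )
  next
    case False
    then have "1 \<le> sum k UNIV" by linarith
    moreover have "1 \<le> i + j \<or> 2 \<le> sum k UNIV"
      using a by (simp add: higher_indices_def fields)
    ultimately have "Suc (Suc M) \<le> i + j + (M + sum k UNIV)" by linarith
    with ord show ?thesis by (rule order_ge_mono)
  qed
qed

section \<open>Weighted sums of coefficients\<close>

definition degree_triangle :: "nat \<Rightarrow> (nat \<times> nat) set" where
  "degree_triangle N = {(m, n). m + n \<le> N}"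

lemma finite_degree_triangle [simp]: "finite (degree_triangle N)"
  by (rule finite_subset[of _ "{..N} \<times> {..N}"]) (auto simp: degree_triangle_def)

text \<open>A truncated weighted \<open>\<ell>\<^sup>1\<close> norm. The truncation keeps all sums finite, and a bound uniform in \<open>N\<close>
  replaces convergence.\<close>

definition wnorm :: "(nat \<Rightarrow> nat \<Rightarrow> real) \<Rightarrow> nat \<Rightarrow> complex fps fps \<Rightarrow> real" where
  "wnorm v N f = (\<Sum>(m, n)\<in>degree_triangle N. cmod (coeff2 f m n) * v m n)"

lemma wnorm_cong:
  assumes "order_ge (Suc N) (f - g)"
  shows "wnorm v N f = wnorm v N g"
  unfolding wnorm_def
proof (rule sum.cong)
  fix x assume x: "x \<in> degree_triangle N"
  obtain m n where mn: "x = (m, n)" by (cases x)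
  have "coeff2 (f - g) m n = 0"
    by (rule order_geD[OF assms]) (use x mn in \<open>auto simp: degree_triangle_def\<close>)
  then show "(case x of (m, n) \<Rightarrow> cmod (coeff2 f m n) * v m n) =
      (case x of (m, n) \<Rightarrow> cmod (coeff2 g m n) * v m n)"
    by (simp add: mn)
qed simp

lemma wnorm_0 [simp]: "wnorm v N 0 = 0"
  by (simp add: wnorm_def)

lemma wnorm_scale: "wnorm v N (fps_const (fps_const a) * f) = cmod a * wnorm v N f"
  unfolding wnorm_def coeff2_scale
  by (simp add: sum_distrib_left case_prod_unfold norm_mult mult.assoc)

locale submultiplicative_weight =
  fixes v :: "nat \<Rightarrow> nat \<Rightarrow> real" and s :: real
  assumes nonneg: "0 \<le> v m n"
    and unit: "v 0 0 \<le> 1"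
    and submult: "v (m + m') (n + n') \<le> v m n * v m' n'"
    and v10: "v 1 0 \<le> s" and v01: "v 0 1 \<le> s"
begin

lemma wnorm_nonneg: "0 \<le> wnorm v N f"
  unfolding wnorm_def by (intro sum_nonneg) (auto simp: nonneg)

lemma wnorm_add: "wnorm v N (f + g) \<le> wnorm v N f + wnorm v N g"
  unfolding wnorm_def sum.distrib[symmetric]
  by (intro sum_mono)
    (auto simp: distrib_right[symmetric] nonneg intro!: mult_right_mono norm_triangle_ineq)

lemma wnorm_diff: "wnorm v N (f - g) \<le> wnorm v N f + wnorm v N g"
  unfolding wnorm_def sum.distrib[symmetric]
  by (intro sum_mono)
    (auto simp: distrib_right[symmetric] nonneg intro!: mult_right_mono norm_triangle_ineq4)

lemma wnorm_sum: "wnorm v N (sum f S) \<le> (\<Sum>l\<in>S. wnorm v N (f l))"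
proof (induction S rule: infinite_finite_induct)
  case (insert x S)
  then show ?case using wnorm_add[of N "f x" "sum f S"] by simp
qed simp_all

text \<open>Each term \<open>f\<^sub>i\<^sub>j g\<^sub>k\<^sub>l\<close> of the product occurs once, in degree \<open>(i + k, j + l)\<close>, and its weight
  is at most the product of the two weights. Pairs with total degree above \<open>N\<close> appear only on the
  right-hand side.\<close>

lemma wnorm_mult: "wnorm v N (f * g) \<le> wnorm v N f * wnorm v N g"
proof -
  define a where "a m n = cmod (coeff2 f m n) * v m n" for m n
  define b where "b m n = cmod (coeff2 g m n) * v m n" for m n
  have ab: "a m n \<ge> 0" "b m n \<ge> 0" for m n by (auto simp: a_def b_def nonneg)
  have le: "cmod (coeff2 (f * g) m n) * v m n
      \<le> (\<Sum>(i, j)\<in>{0..m} \<times> {0..n}. a i j * b (m - i) (n - j))" for m n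
  proof -
    have "cmod (coeff2 (f * g) m n) * v m n
        \<le> (\<Sum>(i, j)\<in>{0..m} \<times> {0..n}. cmod (coeff2 f i j) * cmod (coeff2 g (m - i) (n - j))) * v m n"
      unfolding coeff2_mult sum.cartesian_product
      by (intro mult_right_mono nonneg order_trans[OF norm_sum] sum_mono) (auto simp: norm_mult)
    also have "\<dots> = (\<Sum>(i, j)\<in>{0..m} \<times> {0..n}. cmod (coeff2 f i j) * cmod (coeff2 g (m - i) (n - j)) * v m n)"
      by (simp add: sum_distrib_right case_prod_unfold)
    also have "\<dots> \<le> (\<Sum>(i, j)\<in>{0..m} \<times> {0..n}. a i j * b (m - i) (n - j))"
    proof (intro sum_mono, clarify)
      fix i j assume ij: "i \<in> {0..m}" "j \<in> {0..n}"
      have "v m n \<le> v i j * v (m - i) (n - j)"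
        using submult[of i "m - i" j "n - j"] ij by simp
      then have "cmod (coeff2 f i j) * cmod (coeff2 g (m - i) (n - j)) * v m n
          \<le> cmod (coeff2 f i j) * cmod (coeff2 g (m - i) (n - j)) * (v i j * v (m - i) (n - j))"
        by (intro mult_left_mono) auto
      then show "cmod (coeff2 f i j) * cmod (coeff2 g (m - i) (n - j)) * v m n \<le> a i j * b (m - i) (n - j)"
        by (simp add: a_def b_def mult_ac)
    qed
    finally show ?thesis .
  qed
  have "wnorm v N (f * g) \<le> (\<Sum>(m, n)\<in>degree_triangle N. \<Sum>(i, j)\<in>{0..m} \<times> {0..n}. a i j * b (m - i) (n - j))"
    unfolding wnorm_def by (intro sum_mono) (use le in auto)
  also have "\<dots> = (\<Sum>((m, n), (i, j))\<in>(SIGMA x:degree_triangle N. {0..fst x} \<times> {0..snd x}). a i j * b (m - i) (n - j))"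
    by (simp add: sum.Sigma case_prod_unfold)
  also have "\<dots> \<le> (\<Sum>((i, j), (i', j'))\<in>degree_triangle N \<times> degree_triangle N. a i j * b i' j')"
  proof (rule sum_le_included[where i = "\<lambda>((i :: nat, j :: nat), (i' :: nat, j' :: nat)). ((i + i', j + j'), (i, j))"])
    have "\<exists>y\<in>degree_triangle N \<times> degree_triangle N. (\<lambda>((i, j), (i', j')). ((i + i', j + j'), (i, j))) y = x \<and>
        (\<lambda>((m, n), (i, j)). a i j * b (m - i) (n - j)) x \<le> (\<lambda>((i, j), (i', j')). a i j * b i' j') y"
      if x: "x \<in> (SIGMA x:degree_triangle N. {0..fst x} \<times> {0..snd x})" for x
    proof -
      obtain m n i j where mn: "x = ((m, n), (i, j))" by (metis prod.collapse)
      show ?thesis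
        by (rule bexI[of _ "((i, j), (m - i, n - j))"]) (use x mn in \<open>auto simp: degree_triangle_def\<close>)
    qed
    then show "\<forall>x\<in>(SIGMA x:degree_triangle N. {0..fst x} \<times> {0..snd x}). \<exists>y\<in>degree_triangle N \<times> degree_triangle N.
        (\<lambda>((i, j), (i', j')). ((i + i', j + j'), (i, j))) y = x \<and>
        (\<lambda>((m, n), (i, j)). a i j * b (m - i) (n - j)) x \<le> (\<lambda>((i, j), (i', j')). a i j * b i' j') y"
      by blast
  qed (auto simp: ab)
  also have "\<dots> = wnorm v N f * wnorm v N g"
    unfolding wnorm_def a_def[symmetric] b_def[symmetric]
    by (simp add: sum_product sum.cartesian_product case_prod_unfold)
  finally show ?thesis .
qed

lemma wnorm_1: "wnorm v N 1 \<le> 1"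
proof -
  have "wnorm v N 1 = (\<Sum>x\<in>degree_triangle N. if x = (0, 0) then v 0 0 else 0)"
    unfolding wnorm_def coeff2_1 by (rule sum.cong) (auto split: if_splits)
  also have "\<dots> \<le> 1" using unit by simp
  finally show ?thesis .
qed

lemma s_nonneg: "0 \<le> s"
  using nonneg[of 1 0] v10 by linarith

lemma wnorm_X: "wnorm v N X \<le> s"
proof -
  have "wnorm v N X = (\<Sum>x\<in>degree_triangle N. if x = (1, 0) then v 1 0 else 0)"
    unfolding wnorm_def coeff2_X by (rule sum.cong) (auto split: if_splits)
  also have "\<dots> \<le> s" using v10 s_nonneg by simp
  finally show ?thesis .
qed

lemma wnorm_Eps: "wnorm v N Eps \<le> s"
proof -
  have "wnorm v N Eps = (\<Sum>x\<in>degree_triangle N. if x = (0, 1) then v 0 1 else 0)"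
    unfolding wnorm_def coeff2_Eps by (rule sum.cong) (auto split: if_splits)
  also have "\<dots> \<le> s" using v01 s_nonneg by simp
  finally show ?thesis .
qed

lemma wnorm_power:
  assumes "wnorm v N f \<le> d"
  shows "wnorm v N (f ^ k) \<le> d ^ k"
proof (induction k)
  case 0
  then show ?case using wnorm_1 by simp
next
  case (Suc k)
  have "wnorm v N (f ^ Suc k) \<le> wnorm v N f * wnorm v N (f ^ k)"
    using wnorm_mult by simp
  also have "\<dots> \<le> d * d ^ k"
    by (intro mult_mono assms Suc.IH wnorm_nonneg order_trans[OF wnorm_nonneg assms])
  finally show ?case by simp
qed

lemma wnorm_prod_power:
  assumes "finite S" "\<And>l. wnorm v N (f l) \<le> d"
  shows "wnorm v N (\<Prod>l\<in>S. f l ^ k l) \<le> d ^ sum k S"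
  using assms(1)
proof (induction S rule: finite_induct)
  case empty
  then show ?case using wnorm_1 by simp
next
  case (insert l S)
  have d: "0 \<le> d" using wnorm_nonneg assms(2) by (rule order_trans)
  have "wnorm v N (\<Prod>l\<in>insert l S. f l ^ k l) \<le> wnorm v N (f l ^ k l) * wnorm v N (\<Prod>l\<in>S. f l ^ k l)"
    using wnorm_mult insert.hyps by simp
  also have "\<dots> \<le> d ^ k l * d ^ sum k S"
    using d by (intro mult_mono wnorm_power assms(2) insert.IH wnorm_nonneg) auto
  also have "\<dots> = d ^ sum k (insert l S)"
    using insert.hyps by (simp add: power_add)
  finally show ?case .
qed

lemma wnorm_monomial:
  assumes "\<And>l. wnorm v N (y $ l) \<le> d"
  shows "wnorm v N (monomial (i, j, k) y) \<le> s ^ (i + j) * d ^ sum k UNIV"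
proof -
  have d: "0 \<le> d" using wnorm_nonneg assms by (rule order_trans)
  have "wnorm v N (monomial (i, j, k) y)
      \<le> wnorm v N (X ^ i * Eps ^ j) * wnorm v N (\<Prod>l\<in>UNIV. (y $ l) ^ k l)"
    unfolding monomial_def using wnorm_mult by simp
  also have "\<dots> \<le> (wnorm v N (X ^ i) * wnorm v N (Eps ^ j)) * wnorm v N (\<Prod>l\<in>UNIV. (y $ l) ^ k l)"
    by (intro mult_right_mono wnorm_mult wnorm_nonneg)
  also have "\<dots> \<le> (s ^ i * s ^ j) * d ^ sum k UNIV"
    using d s_nonneg
    by (intro mult_mono wnorm_power wnorm_X wnorm_Eps wnorm_prod_power assms wnorm_nonneg mult_nonneg_nonneg) auto
  finally show ?thesis by (simp add: power_add)
qed

end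

section \<open>The fixed point equation\<close>

text \<open>The matrix \<open>B\<close> plays the role of the inverse Jacobian and \<open>c\<close> that of the Taylor coefficients of
  \<open>F\<close>; \<open>lam\<close> gives the factors \<open>q\<^sup>m\<close> or \<open>[m]\<^sub>q\<close>.\<close>

locale shifted_fixed_point =
  fixes c :: "nat \<times> nat \<times> ('n::finite \<Rightarrow> nat) \<Rightarrow> complex ^ 'n"
    and B :: "complex ^ 'n ^ 'n"
    and lam :: "nat \<Rightarrow> complex"
    and p \<alpha> :: nat
  assumes \<alpha>: "\<alpha> > 0"
begin

definition shift :: "complex fps fps \<Rightarrow> complex fps fps" where
  "shift f = Abs_fps (\<lambda>m. Abs_fps (\<lambda>n.
     if p \<le> m \<and> \<alpha> \<le> n then lam (m - p) * coeff2 f (m - p) (n - \<alpha>) else 0))"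

definition higher_part :: "(complex fps fps) ^ 'n \<Rightarrow> 'n \<Rightarrow> complex fps fps" where
  "higher_part y h = Abs_fps (\<lambda>m. Abs_fps (\<lambda>n.
     \<Sum>a\<in>higher_indices (m + n). c a $ h * coeff2 (monomial a y) m n))"

definition fp_map :: "(complex fps fps) ^ 'n \<Rightarrow> (complex fps fps) ^ 'n" where
  "fp_map y = (\<chi> h. \<Sum>l\<in>UNIV. fps_const (fps_const (B $ h $ l)) * (shift (y $ l) - higher_part y l))"

lemma coeff2_shift:
  "coeff2 (shift f) m n =
     (if p \<le> m \<and> \<alpha> \<le> n then lam (m - p) * coeff2 f (m - p) (n - \<alpha>) else 0)"
  by (simp add: shift_def)

lemma coeff2_higher_part:
  "coeff2 (higher_part y h) m n = (\<Sum>a\<in>higher_indices (m + n). c a $ h * coeff2 (monomial a y) m n)"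
  by (simp add: higher_part_def)

text \<open>The index set of the defining sum depends on the degree; with a common index set for all degrees up
  to \<open>N\<close>, the series agrees up to degree \<open>N\<close> with a finite sum of monomials in the ring.\<close>

lemma coeff2_higher_part_eq:
  assumes y: "\<And>l. order_ge 1 (y $ l)" and N: "m + n \<le> N"
  shows "coeff2 (higher_part y h) m n = (\<Sum>a\<in>higher_indices N. c a $ h * coeff2 (monomial a y) m n)"
  unfolding coeff2_higher_part
proof (rule sum.mono_neutral_left)
  show "higher_indices (m + n) \<subseteq> higher_indices N"
    using N by (auto simp: higher_indices_def)
  show "\<forall>a\<in>higher_indices N - higher_indices (m + n). c a $ h * coeff2 (monomial a y) m n = 0"
  proof
    fix a :: "nat \<times> nat \<times> ('n \<Rightarrow> nat)" assume "a \<in> higher_indices N - higher_indices (m + n)"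
    then have "m + n < index_degree a"
      by (cases a) (auto simp: higher_indices_def)
    then show "c a $ h * coeff2 (monomial a y) m n = 0"
      using order_geD[OF order_ge_monomial[of y a, OF y]] by simp
  qed
qed simp

lemma coeff2_fp_map:
  "coeff2 (fp_map y $ h) m n = (\<Sum>l\<in>UNIV. B $ h $ l * (coeff2 (shift (y $ l)) m n - coeff2 (higher_part y l) m n))"
  by (simp add: fp_map_def fps_sum_nth)

lemma order_ge_fp_map: "order_ge 1 (fp_map y $ h)"
proof -
  have "higher_indices 0 = ({} :: (nat \<times> nat \<times> ('n \<Rightarrow> nat)) set)"
    by (auto simp: higher_indices_def)
  then show ?thesis
    using \<alpha> by (simp add: order_ge_def coeff2_fp_map coeff2_shift coeff2_higher_part)
qed

text \<open>The map \<open>shift\<close> raises the order by \<open>p + \<alpha> > 0\<close>, and the monomials of \<open>higher_part\<close> gain an order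
  on differences.\<close>

lemma fp_map_contracts:
  assumes y: "\<And>l. order_ge 1 (y $ l)" and z: "\<And>l. order_ge 1 (z $ l)"
    and yz: "\<And>l. order_ge (Suc M) (y $ l - z $ l)"
  shows "order_ge (Suc (Suc M)) (fp_map y $ h - fp_map z $ h)"
  unfolding order_ge_def
proof (intro allI impI)
  fix m n assume mn: "m + n < Suc (Suc M)"
  have "coeff2 (shift (y $ l)) m n = coeff2 (shift (z $ l)) m n" for l
    using order_geD[OF yz[of l], of "m - p" "n - \<alpha>"] mn \<alpha> by (auto simp: coeff2_shift)
  moreover have "coeff2 (higher_part y l) m n = coeff2 (higher_part z l) m n" for l
    unfolding coeff2_higher_part
  proof (rule sum.cong)
    fix a :: "nat \<times> nat \<times> ('n \<Rightarrow> nat)" assume "a \<in> higher_indices (m + n)"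
    from order_geD[OF order_ge_monomial_diff[of a "m + n" y z, OF this y z yz] mn]
    show "c a $ l * coeff2 (monomial a y) m n = c a $ l * coeff2 (monomial a z) m n" by simp
  qed simp
  ultimately show "coeff2 (fp_map y $ h - fp_map z $ h) m n = 0"
    by (simp add: coeff2_fp_map)
qed

lemma fixed_point_unique:
  assumes y: "\<And>l. order_ge 1 (y $ l)" "fp_map y = y" and z: "\<And>l. order_ge 1 (z $ l)" "fp_map z = z"
  shows "y = z"
proof -
  have "order_ge (Suc M) (y $ h - z $ h)" for M h
  proof (induction M arbitrary: h)
    case 0
    then show ?case using order_ge_diff[OF y(1) z(1)] by simp
  next
    case (Suc M)
    then show ?case using fp_map_contracts[OF y(1) z(1), of M h] y(2) z(2) by simp
  qed
  then have "coeff2 (y $ h) m n = coeff2 (z $ h) m n" for h m n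
    using order_geD[of "Suc (m + n)" "y $ h - z $ h" m n] by simp
  then show ?thesis by (simp add: vec_eq_iff fps_eq_iff)
qed

definition iterate :: "nat \<Rightarrow> (complex fps fps) ^ 'n" where
  "iterate t = (fp_map ^^ t) 0"

lemma iterate_Suc: "iterate (Suc t) = fp_map (iterate t)"
  by (simp add: iterate_def)

lemma order_ge_iterate: "order_ge 1 (iterate t $ h)"
  by (cases t) (simp_all only: iterate_Suc order_ge_fp_map, simp add: iterate_def)

lemma order_ge_iterate_step: "order_ge (Suc t) (iterate (Suc t) $ h - iterate t $ h)"
proof (induction t arbitrary: h)
  case 0
  then show ?case using order_ge_diff[OF order_ge_iterate order_ge_iterate] by simp
next
  case (Suc t)
  show ?case
    unfolding iterate_Suc[of "Suc t"] iterate_Suc[of t]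
    by (rule fp_map_contracts) (use Suc order_ge_iterate order_ge_fp_map in \<open>auto simp: iterate_Suc\<close>)
qed

lemma order_ge_iterate_diff: "order_ge (Suc t) (iterate (t + d) $ h - iterate t $ h)"
proof (induction d)
  case (Suc d)
  have "order_ge (Suc t) (iterate (Suc (t + d)) $ h - iterate (t + d) $ h)"
    by (rule order_ge_mono[OF order_ge_iterate_step]) simp
  from order_ge_add[OF this Suc] show ?case by simp
qed simp

text \<open>The coefficients of degree \<open>N\<close> of the iterates are constant from the iterate \<open>N\<close> on.\<close>

definition limit :: "(complex fps fps) ^ 'n" where
  "limit = (\<chi> h. Abs_fps (\<lambda>m. Abs_fps (\<lambda>n. coeff2 (iterate (m + n) $ h) m n)))"

lemma order_ge_limit_iterate: "order_ge (Suc t) (limit $ h - iterate t $ h)"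
  unfolding order_ge_def
proof (intro allI impI)
  fix m n assume "m + n < Suc t"
  then obtain d where "t = m + n + d" using less_Suc_eq_le le_Suc_ex by blast
  then show "coeff2 (limit $ h - iterate t $ h) m n = 0"
    using order_geD[OF order_ge_iterate_diff[of "m + n" d h], of m n] by (simp add: limit_def)
qed

lemma order_ge_limit: "order_ge 1 (limit $ h)"
  using order_ge_add[OF order_ge_mono[OF order_ge_limit_iterate[of 0 h]] order_ge_iterate[of 0 h]] by simp

lemma limit_fixed_point: "fp_map limit = limit"
proof -
  have "coeff2 (fp_map limit $ h) m n = coeff2 (limit $ h) m n" for h m n
  proof -
    define t where "t = m + n"
    have "coeff2 (fp_map limit $ h - iterate (Suc t) $ h) m n = 0"
      unfolding iterate_Suc
      by (rule order_geD[OF fp_map_contracts[OF order_ge_limit order_ge_iterate order_ge_limit_iterate]])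
        (simp add: t_def)
    moreover have "coeff2 (limit $ h - iterate (Suc t) $ h) m n = 0"
      by (rule order_geD[OF order_ge_limit_iterate]) (simp add: t_def)
    ultimately show ?thesis by simp
  qed
  then show ?thesis by (simp add: vec_eq_iff fps_eq_iff)
qed

lemma fixed_point_eq_limit:
  assumes "\<And>l. order_ge 1 (y $ l)" "fp_map y = y"
  shows "y = limit"
  by (rule fixed_point_unique[OF assms order_ge_limit limit_fixed_point])

lemma wnorm_shift:
  assumes "submultiplicative_weight v s"
    and \<theta>: "\<And>m n. cmod (lam m) * v (m + p) (n + \<alpha>) \<le> \<theta> * v m n"
  shows "wnorm v N (shift f) \<le> \<theta> * wnorm v N f"
proof -
  interpret submultiplicative_weight v s by fact
  let ?T = "{(m, n). m + n + p + \<alpha> \<le> N}"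
  have fin: "finite ?T"
    by (rule finite_subset[OF _ finite_degree_triangle[of N]]) (auto simp: degree_triangle_def)
  have "wnorm v N (shift f) = (\<Sum>(m, n)\<in>(\<lambda>(m, n). (m + p, n + \<alpha>)) ` ?T. cmod (coeff2 (shift f) m n) * v m n)"
    unfolding wnorm_def
  proof (rule sum.mono_neutral_right)
    show "\<forall>x\<in>degree_triangle N - (\<lambda>(m, n). (m + p, n + \<alpha>)) ` ?T.
        (case x of (m, n) \<Rightarrow> cmod (coeff2 (shift f) m n) * v m n) = 0"
    proof clarify
      fix m n assume mn: "(m, n) \<in> degree_triangle N" "(m, n) \<notin> (\<lambda>(m, n). (m + p, n + \<alpha>)) ` ?T"
      have "\<not> (p \<le> m \<and> \<alpha> \<le> n)"
      proof
        assume "p \<le> m \<and> \<alpha> \<le> n"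
        then have "(m, n) = (\<lambda>(m, n). (m + p, n + \<alpha>)) (m - p, n - \<alpha>)" "(m - p, n - \<alpha>) \<in> ?T"
          using mn(1) by (auto simp: degree_triangle_def)
        with mn(2) show False by blast
      qed
      then show "cmod (coeff2 (shift f) m n) * v m n = 0" by (auto simp: coeff2_shift)
    qed
  qed (use finite_degree_triangle[of N] in \<open>auto simp: degree_triangle_def\<close>)
  also have "\<dots> = (\<Sum>(m, n)\<in>?T. cmod (lam m * coeff2 f m n) * v (m + p) (n + \<alpha>))"
    by (subst sum.reindex) (auto simp: inj_on_def coeff2_shift case_prod_unfold)
  also have "\<dots> \<le> (\<Sum>(m, n)\<in>?T. \<theta> * (cmod (coeff2 f m n) * v m n))"
  proof (intro sum_mono, clarify)
    fix m n
    have "cmod (coeff2 f m n) * (cmod (lam m) * v (m + p) (n + \<alpha>)) \<le> cmod (coeff2 f m n) * (\<theta> * v m n)"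
      by (intro mult_left_mono \<theta>) auto
    then show "cmod (lam m * coeff2 f m n) * v (m + p) (n + \<alpha>) \<le> \<theta> * (cmod (coeff2 f m n) * v m n)"
      by (simp add: norm_mult mult_ac)
  qed
  also have "\<dots> \<le> (\<Sum>(m, n)\<in>degree_triangle N. \<theta> * (cmod (coeff2 f m n) * v m n))"
  proof (rule sum_mono2)
    show "?T \<subseteq> degree_triangle N" by (auto simp: degree_triangle_def)
    fix x assume "x \<in> degree_triangle N - ?T"
    obtain m n where x: "x = (m, n)" by (cases x)
    have "0 \<le> cmod (lam m) * v (m + p) (n + \<alpha>)" by (simp add: nonneg)
    then have "0 \<le> \<theta> * v m n" using \<theta>[of m n] by linarith
    then have "0 \<le> cmod (coeff2 f m n) * (\<theta> * v m n)" by simp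
    then show "0 \<le> (case x of (m, n) \<Rightarrow> \<theta> * (cmod (coeff2 f m n) * v m n))"
      by (simp add: x mult_ac)
  qed simp
  also have "\<dots> = \<theta> * wnorm v N f"
    by (simp add: wnorm_def sum_distrib_left case_prod_unfold)
  finally show ?thesis .
qed

text \<open>With \<open>u = s / \<rho>\<close> and \<open>w = d / \<rho>\<close>, both at most \<open>1\<close>, each admitted monomial satisfies
  \<open>s\<^bsup>i + j\<^esup> d\<^bsup>|k|\<^esup> \<le> \<rho>\<^bsup>i + j + |k|\<^esup> (u + w\<^sup>2)\<close>: either \<open>u\<close> or \<open>w\<^sup>2\<close> can be split off. The rest is the
  absolutely convergent sum at radius \<open>\<rho>\<close>.\<close>

lemma wnorm_higher_part:
  assumes "submultiplicative_weight v s"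
    and \<rho>: "0 < \<rho>" "s \<le> \<rho>" "d \<le> \<rho>"
    and K: "\<And>I. finite I \<Longrightarrow> (\<Sum>a\<in>I. cmod (c a $ h) * \<rho> ^ index_degree a) \<le> K"
    and y: "\<And>l. order_ge 1 (y $ l)" "\<And>l. wnorm v N (y $ l) \<le> d"
  shows "wnorm v N (higher_part y h) \<le> K * (s / \<rho> + (d / \<rho>)\<^sup>2)"
proof -
  interpret submultiplicative_weight v s by fact
  have d: "0 \<le> d" using wnorm_nonneg y(2) by (rule order_trans)
  define u where "u = s / \<rho>"
  define w where "w = d / \<rho>"
  have uw: "0 \<le> u" "u \<le> 1" "0 \<le> w" "w \<le> 1" using \<rho> d s_nonneg by (auto simp: u_def w_def)
  let ?H = "higher_indices N"
  let ?g = "\<Sum>a\<in>?H. fps_const (fps_const (c a $ h)) * monomial a y"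
  have "order_ge (Suc N) (higher_part y h - ?g)"
    by (auto simp: order_ge_def coeff2_higher_part_eq[OF y(1), of _ _ N] fps_sum_nth)
  then have "wnorm v N (higher_part y h) = wnorm v N ?g" by (rule wnorm_cong)
  also have "\<dots> \<le> (\<Sum>a\<in>?H. cmod (c a $ h) * wnorm v N (monomial a y))"
    using wnorm_sum[of N "\<lambda>a. fps_const (fps_const (c a $ h)) * monomial a y" ?H] by (simp add: wnorm_scale)
  also have "\<dots> \<le> (\<Sum>a\<in>?H. (cmod (c a $ h) * \<rho> ^ index_degree a) * (u + w\<^sup>2))"
  proof (rule sum_mono)
    fix a :: "nat \<times> nat \<times> ('n \<Rightarrow> nat)" assume a: "a \<in> ?H"
    obtain i j k where ijk: "a = (i, j, k)" by (cases a)
    have "u ^ (i + j) * w ^ sum k UNIV \<le> u + w\<^sup>2"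
    proof (cases "1 \<le> i + j")
      case True
      then have "u ^ (i + j) \<le> u ^ 1" by (intro power_decreasing uw)
      moreover have "w ^ sum k UNIV \<le> 1" by (intro power_le_one uw)
      ultimately have "u ^ (i + j) * w ^ sum k UNIV \<le> u ^ 1 * 1"
        using uw by (intro mult_mono) auto
      then show ?thesis by simp (smt (verit) zero_le_power2)
    next
      case False
      then have "w ^ sum k UNIV \<le> w\<^sup>2"
        using a by (intro power_decreasing uw) (auto simp: higher_indices_def ijk)
      moreover have "u ^ (i + j) \<le> 1" by (intro power_le_one uw)
      ultimately have "u ^ (i + j) * w ^ sum k UNIV \<le> 1 * w\<^sup>2"
        using uw by (intro mult_mono) auto
      then show ?thesis using uw by simp
    qed
    moreover have "s ^ (i + j) * d ^ sum k UNIV = \<rho> ^ index_degree a * (u ^ (i + j) * w ^ sum k UNIV)"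
      using \<rho>(1) by (simp add: ijk u_def w_def power_divide power_add)
    ultimately have "s ^ (i + j) * d ^ sum k UNIV \<le> \<rho> ^ index_degree a * (u + w\<^sup>2)"
      using \<rho>(1) by (simp add: mult_left_mono)
    then have "wnorm v N (monomial a y) \<le> \<rho> ^ index_degree a * (u + w\<^sup>2)"
      using wnorm_monomial[of N y d i j k, OF y(2)] by (simp add: ijk)
    then have "cmod (c a $ h) * wnorm v N (monomial a y) \<le> cmod (c a $ h) * (\<rho> ^ index_degree a * (u + w\<^sup>2))"
      by (intro mult_left_mono) auto
    then show "cmod (c a $ h) * wnorm v N (monomial a y) \<le> (cmod (c a $ h) * \<rho> ^ index_degree a) * (u + w\<^sup>2)"
      by (simp add: mult.assoc)
  qed
  also have "\<dots> = (\<Sum>a\<in>?H. cmod (c a $ h) * \<rho> ^ index_degree a) * (u + w\<^sup>2)"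
    by (simp add: sum_distrib_right)
  also have "\<dots> \<le> K * (u + w\<^sup>2)"
    using uw by (intro mult_right_mono K) auto
  finally show ?thesis by (simp add: u_def w_def)
qed

text \<open>All iterates stay in the ball of radius \<open>d\<close>, and the limit agrees with the iterate \<open>N\<close> up to degree \<open>N\<close>.\<close>

lemma wnorm_limit_le:
  assumes "submultiplicative_weight v s"
    and \<theta>: "\<And>m n. cmod (lam m) * v (m + p) (n + \<alpha>) \<le> \<theta> * v m n"
    and \<rho>: "0 < \<rho>" "s \<le> \<rho>" "0 \<le> d" "d \<le> \<rho>"
    and K: "\<And>I h. finite I \<Longrightarrow> (\<Sum>a\<in>I. cmod (c a $ h) * \<rho> ^ index_degree a) \<le> K"
    and b: "\<And>h. (\<Sum>l\<in>UNIV. cmod (B $ h $ l)) \<le> b"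
    and \<theta>0: "0 \<le> \<theta>"
    and small: "b * (\<theta> * d + K * (s / \<rho> + (d / \<rho>)\<^sup>2)) \<le> d"
  shows "wnorm v N (limit $ h) \<le> d"
proof -
  interpret submultiplicative_weight v s by fact
  have "wnorm v N (iterate t $ h) \<le> d" for t
  proof (induction t arbitrary: h)
    case 0
    then show ?case using \<rho> by (simp add: iterate_def)
  next
    case (Suc t)
    let ?y = "iterate t"
    define e where "e = \<theta> * d + K * (s / \<rho> + (d / \<rho>)\<^sup>2)"
    have e: "wnorm v N (shift (?y $ l) - higher_part ?y l) \<le> e" for l
    proof -
      have "wnorm v N (shift (?y $ l)) \<le> \<theta> * wnorm v N (?y $ l)"
        by (rule wnorm_shift[OF assms(1) \<theta>])
      also have "\<dots> \<le> \<theta> * d" using \<theta>0 Suc.IH by (intro mult_left_mono)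
      finally show ?thesis
        using wnorm_diff[of N "shift (?y $ l)" "higher_part ?y l"]
          wnorm_higher_part[OF assms(1) \<rho>(1,2,4) K order_ge_iterate Suc.IH, of l]
        by (simp add: e_def)
    qed
    have e0: "0 \<le> e" using wnorm_nonneg e by (rule order_trans)
    have "wnorm v N (iterate (Suc t) $ h)
        \<le> (\<Sum>l\<in>UNIV. cmod (B $ h $ l) * wnorm v N (shift (?y $ l) - higher_part ?y l))"
      unfolding iterate_Suc fp_map_def
      using wnorm_sum[of N "\<lambda>l. fps_const (fps_const (B $ h $ l)) * (shift (?y $ l) - higher_part ?y l)" UNIV]
      by (simp add: wnorm_scale)
    also have "\<dots> \<le> (\<Sum>l\<in>UNIV. cmod (B $ h $ l) * e)"
      by (intro sum_mono mult_left_mono e) auto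
    also have "\<dots> = (\<Sum>l\<in>UNIV. cmod (B $ h $ l)) * e" by (simp add: sum_distrib_right)
    also have "\<dots> \<le> b * e" by (intro mult_right_mono b e0)
    also have "\<dots> \<le> d" using small by (simp add: e_def)
    finally show ?case .
  qed
  moreover have "wnorm v N (limit $ h) = wnorm v N (iterate N $ h)"
    by (rule wnorm_cong[OF order_ge_limit_iterate])
  ultimately show ?thesis by simp
qed

end

text \<open>The quadratic term fixes \<open>d\<close>. Once \<open>d\<close> is known, the
  term \<open>K s / \<rho>\<close>, which has no factor \<open>d\<close>, forces \<open>s\<close> to be small compared with \<open>d\<close>. Each of the three contributes at most \<open>d / 4\<close>.\<close>

lemma invariant_radius_exists:
  fixes b K \<Lambda> \<rho> :: real
  assumes "b > 0" "K > 0" "\<Lambda> > 0" "\<rho> > 0"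
  obtains s d where "0 < s" "s \<le> 1" "s \<le> \<rho>" "0 < d" "d \<le> \<rho>"
    "b * (\<Lambda> * s * d + K * (s / \<rho> + (d / \<rho>)\<^sup>2)) \<le> d"
proof -
  define d where "d = min \<rho> (\<rho>\<^sup>2 / (4 * b * K))"
  have d: "0 < d" "d \<le> \<rho>" "d \<le> \<rho>\<^sup>2 / (4 * b * K)" using assms by (auto simp: d_def)
  define s where "s = min (min 1 \<rho>) (min (1 / (4 * b * \<Lambda>)) (d * \<rho> / (4 * b * K)))"
  have s: "0 < s" "s \<le> 1" "s \<le> \<rho>" "s \<le> 1 / (4 * b * \<Lambda>)" "s \<le> d * \<rho> / (4 * b * K)"
    using assms d by (auto simp: s_def)
  have "b * \<Lambda> * s \<le> 1 / 4"
    using mult_left_mono[OF s(4), of "b * \<Lambda>"] assms by simp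
  then have 1: "b * \<Lambda> * s * d \<le> d / 4"
    using mult_right_mono[of "b * \<Lambda> * s" "1 / 4" d] d by simp
  have 2: "b * K * (s / \<rho>) \<le> d / 4"
    using mult_left_mono[OF s(5), of "b * K / \<rho>"] assms by simp
  have "b * K * d / \<rho>\<^sup>2 \<le> 1 / 4"
    using mult_left_mono[OF d(3), of "b * K / \<rho>\<^sup>2"] assms by simp
  then have "b * K * d / \<rho>\<^sup>2 * d \<le> 1 / 4 * d"
    using d by (intro mult_right_mono) auto
  then have 3: "b * K * (d / \<rho>)\<^sup>2 \<le> d / 4"
    by (simp add: power_divide power2_eq_square mult_ac)
  have "b * (\<Lambda> * s * d + K * (s / \<rho> + (d / \<rho>)\<^sup>2))
      = b * \<Lambda> * s * d + b * K * (s / \<rho>) + b * K * (d / \<rho>)\<^sup>2"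
    by (simp add: algebra_simps)
  also have "\<dots> \<le> d" using 1 2 3 d by linarith
  finally show ?thesis using that s d by blast
qed

section \<open>Formal solutions as fixed points\<close>

lemma zero_constant_term_iff_order_ge: "zero_constant_term y \<longleftrightarrow> (\<forall>l. order_ge 1 (y $ l))"
  by (auto simp: zero_constant_term_def order_ge_def)

lemma coeff2_Eps_X_mult:
  "coeff2 (Eps ^ j * X ^ i * f) m n = (if i \<le> m \<and> j \<le> n then coeff2 f (m - i) (n - j) else 0)"
proof -
  have "Eps ^ j * X ^ i * f = X ^ i * (Eps ^ j * f)" by (simp only: mult_ac)
  also have "fps_nth \<dots> m = (if m < i then 0 else fps_nth (Eps ^ j * f) (m - i))"
    unfolding X_def by (rule fps_X_power_mult_nth)
  also have "fps_nth (Eps ^ j * f) (m - i) = fps_X ^ j * fps_nth f (m - i)"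
    by (simp add: Eps_def)
  finally show ?thesis by (simp add: fps_X_power_mult_nth)
qed

lemma sum_unit_index [simp]: "sum (unit_index l) UNIV = 1"
  by (simp add: unit_index_def sum.If_cases fun_upd_def)

lemma prod_unit_index: "(\<Prod>l'\<in>UNIV. f l' ^ unit_index l l') = (f l :: 'a :: comm_monoid_mult)"
proof -
  have "(\<Prod>l'\<in>UNIV. f l' ^ unit_index l l') = (\<Prod>l'\<in>UNIV. if l' = l then f l else 1)"
    by (rule prod.cong) (auto simp: unit_index_def)
  then show ?thesis by simp
qed

lemma sum_eq_1_imp_unit_index:
  fixes k :: "'n::finite \<Rightarrow> nat"
  assumes "sum k UNIV = 1"
  shows "\<exists>l. k = unit_index l"
proof -
  obtain l where l: "k l = 1" "\<And>l'. l' \<noteq> l \<Longrightarrow> k l' = 0"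
    using assms sum_eq_1_iff[of UNIV k] by auto
  then show ?thesis by (intro exI[of _ l]) (auto simp: unit_index_def fun_eq_iff)
qed

text \<open>The nonzero terms have total degree at most \<open>m + n\<close>. Those with \<open>i = j = 0\<close> and \<open>|k| = 1\<close> form the
  linear part.\<close>

lemma coeff2_formal_compose:
  fixes y :: "(complex fps fps) ^ 'n::finite"
  assumes c0: "taylor_coeff F (0, 0, \<lambda>_. 0) = 0"
    and y: "\<And>l. order_ge 1 (y $ l)"
  shows "coeff2 (formal_compose F y $ h) m n =
    (\<Sum>l\<in>UNIV. taylor_coeff F (0, 0, unit_index l) $ h * coeff2 (y $ l) m n) +
    (\<Sum>a\<in>higher_indices (m + n). taylor_coeff F a $ h * coeff2 (monomial a y) m n)"
proof -
  let ?t = "\<lambda>a. taylor_coeff F a $ h * coeff2 (monomial a y) m n"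
  define L where "L = range (\<lambda>l::'n. (0::nat, 0::nat, unit_index l))"
  have "coeff2 (formal_compose F y $ h) m n = Sum_any ?t"
    by (simp add: formal_compose_def monomial_def case_prod_unfold)
  also have "\<dots> = sum ?t (L \<union> higher_indices (m + n))"
  proof (rule Sum_any.expand_superset)
    show "finite (L \<union> higher_indices (m + n))" by (simp add: L_def)
    show "{a. ?t a \<noteq> 0} \<subseteq> L \<union> higher_indices (m + n)"
    proof
      fix a assume a: "a \<in> {a. ?t a \<noteq> 0}"
      obtain i j k where ijk: "a = (i, j, k)" by (cases a)
      have deg: "index_degree a \<le> m + n"
        using order_geD[OF order_ge_monomial[of y a, OF y], of m n] a by force
      show "a \<in> L \<union> higher_indices (m + n)"
      proof (cases "1 \<le> i + j \<or> 2 \<le> sum k UNIV")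
        case True
        with deg show ?thesis by (simp add: higher_indices_def ijk)
      next
        case False
        then have ij: "i = 0" "j = 0" and "sum k UNIV = 0 \<or> sum k UNIV = 1" by linarith+
        then show ?thesis
        proof (elim disjE)
          assume "sum k UNIV = 0"
          then have "k l = 0" for l using member_le_sum[of l UNIV k] by simp
          then have "k = (\<lambda>_. 0)" by (simp add: fun_eq_iff)
          with a c0 ij show ?thesis by (simp add: ijk)
        next
          assume "sum k UNIV = 1"
          then show ?thesis using sum_eq_1_imp_unit_index[of k] ij by (auto simp: L_def ijk)
        qed
      qed
    qed
  qed
  also have "\<dots> = sum ?t L + sum ?t (higher_indices (m + n))"
    by (rule sum.union_disjoint[OF _ finite_higher_indices]) (auto simp: L_def higher_indices_def)
  also have "sum ?t L = (\<Sum>l\<in>UNIV. ?t (0, 0, unit_index l))"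
  proof -
    have "inj (\<lambda>l::'n. (0::nat, 0::nat, unit_index l))"
    proof (rule injI)
      fix l l' :: 'n assume "(0::nat, 0::nat, unit_index l) = (0, 0, unit_index l')"
      then have "unit_index l l = unit_index l' l" by simp
      then show "l = l'" by (simp add: unit_index_def split: if_splits)
    qed
    then show ?thesis unfolding L_def by (subst sum.reindex) auto
  qed
  also have "\<dots> = (\<Sum>l\<in>UNIV. taylor_coeff F (0, 0, unit_index l) $ h * coeff2 (y $ l) m n)"
    by (simp add: monomial_def prod_unit_index)
  finally show ?thesis .
qed

text \<open>Degree by degree, the system is \<open>S = J V + T\<close> for the coefficient vectors of \<open>op y\<close>, \<open>y\<close> and the
  higher part, and \<open>J\<close> can be inverted.\<close>

lemma (in shifted_fixed_point) formal_solution_iff_fixed_point: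
  fixes op :: "complex fps fps \<Rightarrow> complex fps fps"
  assumes c: "c = taylor_coeff F" and c0: "taylor_coeff F (0, 0, \<lambda>_. 0) = 0"
    and J: "\<And>h l. J $ h $ l = taylor_coeff F (0, 0, unit_index l) $ h"
    and BJ: "B ** J = mat 1" "J ** B = mat 1"
    and op: "\<And>f m n. coeff2 (op f) m n = coeff2 (shift f) m n"
  shows "zero_constant_term y \<and> (\<chi> i. op (y $ i)) = formal_compose F y
    \<longleftrightarrow> (\<forall>l. order_ge 1 (y $ l)) \<and> fp_map y = y"
proof (cases "zero_constant_term y")
  case True
  then have y: "\<And>l. order_ge 1 (y $ l)" by (simp add: zero_constant_term_iff_order_ge)
  define V where "V m n = (\<chi> h. coeff2 (y $ h) m n)" for m n
  define S where "S m n = (\<chi> h. coeff2 (shift (y $ h)) m n)" for m n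
  define T where "T m n = (\<chi> h. coeff2 (higher_part y h) m n)" for m n
  have "coeff2 (formal_compose F y $ h) m n = (J *v V m n + T m n) $ h" for h m n
    using coeff2_formal_compose[OF c0 y, of h m n]
    by (simp add: T_def V_def matrix_vector_mult_def J coeff2_higher_part flip: c)
  then have "(\<chi> i. op (y $ i)) = formal_compose F y \<longleftrightarrow> (\<forall>m n. S m n = J *v V m n + T m n)"
    by (auto simp: vec_eq_iff fps_eq_iff op S_def)
  also have "\<dots> \<longleftrightarrow> (\<forall>m n. B *v (S m n - T m n) = V m n)"
  proof -
    have "a = J *v x + b \<longleftrightarrow> B *v (a - b) = x" for a b x
    proof
      assume "a = J *v x + b"
      then show "B *v (a - b) = x" by (simp add: matrix_vector_mul_assoc BJ)
    next
      assume "B *v (a - b) = x"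
      then have "J *v x = a - b" by (auto simp: matrix_vector_mul_assoc BJ)
      then show "a = J *v x + b" by simp
    qed
    then show ?thesis by simp
  qed
  also have "\<dots> \<longleftrightarrow> fp_map y = y"
  proof -
    have "coeff2 (fp_map y $ h) m n = (B *v (S m n - T m n)) $ h" for h m n
      by (simp add: coeff2_fp_map S_def T_def matrix_vector_mult_def)
    then show ?thesis by (auto simp: vec_eq_iff fps_eq_iff V_def)
  qed
  finally show ?thesis using True y by simp
qed (auto simp: zero_constant_term_iff_order_ge)

section \<open>Growth exponents\<close>

text \<open>The second condition makes \<open>s\<^bsup>m + n\<^esup> Q\<^bsup>- w(m, n)\<^esup>\<close> submultiplicative, the third makes it absorb the
  factor \<open>Q\<^sup>m\<close> in the bound on the factors of the shift operator.\<close>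

definition growth_exponent :: "nat \<Rightarrow> nat \<Rightarrow> (nat \<Rightarrow> nat \<Rightarrow> real) \<Rightarrow> bool" where
  "growth_exponent p \<alpha> w \<longleftrightarrow> (\<forall>m n. 0 \<le> w m n) \<and>
     (\<forall>m n m' n'. w m n + w m' n' \<le> w (m + m') (n + n')) \<and>
     (\<forall>m n. w m n + real m \<le> w (m + p) (n + \<alpha>))"

definition q_weight :: "real \<Rightarrow> real \<Rightarrow> (nat \<Rightarrow> nat \<Rightarrow> real) \<Rightarrow> nat \<Rightarrow> nat \<Rightarrow> real" where
  "q_weight Q s w m n = s ^ (m + n) * Q powr (- w m n)"

lemma q_weight_submultiplicative:
  assumes Q: "1 < Q" and s: "0 < s"
    and w: "\<And>m n. 0 \<le> w m n" "\<And>m n m' n'. w m n + w m' n' \<le> w (m + m') (n + n')"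
  shows "submultiplicative_weight (q_weight Q s w) s"
proof
  have le1: "Q powr (- w m n) \<le> 1" for m n
    using powr_mono[of "- w m n" 0 Q] w(1)[of m n] Q by simp
  show "0 \<le> q_weight Q s w m n" for m n using s by (simp add: q_weight_def)
  show "q_weight Q s w 0 0 \<le> 1" using le1 by (simp add: q_weight_def)
  show "q_weight Q s w 1 0 \<le> s" "q_weight Q s w 0 1 \<le> s"
    using le1 s by (auto simp: q_weight_def mult_left_le)
  fix m n m' n'
  have "Q powr (- w (m + m') (n + n')) \<le> Q powr (- w m n + - w m' n')"
    using w(2)[of m n m' n'] Q by (intro powr_mono) auto
  also have "\<dots> = Q powr (- w m n) * Q powr (- w m' n')" by (rule powr_add)
  finally have "s ^ (m + m' + (n + n')) * Q powr (- w (m + m') (n + n'))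
      \<le> s ^ (m + m' + (n + n')) * (Q powr (- w m n) * Q powr (- w m' n'))"
    using s by (intro mult_left_mono) auto
  then show "q_weight Q s w (m + m') (n + n') \<le> q_weight Q s w m n * q_weight Q s w m' n'"
    by (simp add: q_weight_def power_add mult_ac)
qed

lemma q_weight_shift:
  assumes Q: "1 < Q" and s: "0 < s" "s \<le> 1" and \<alpha>: "0 < \<alpha>" and \<Lambda>: "0 \<le> \<Lambda>"
    and lam: "\<And>m. cmod (lam m) \<le> \<Lambda> * Q ^ m"
    and w: "\<And>m n. w m n + real m \<le> w (m + p) (n + \<alpha>)"
  shows "cmod (lam m) * q_weight Q s w (m + p) (n + \<alpha>) \<le> \<Lambda> * s * q_weight Q s w m n"
proof -
  have "s ^ (m + p + (n + \<alpha>)) \<le> s ^ (1 + (m + n))"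
    using s \<alpha> by (intro power_decreasing) auto
  moreover have "Q powr (- w (m + p) (n + \<alpha>)) \<le> Q powr (- w m n - real m)"
    using w[of m n] Q by (intro powr_mono) auto
  ultimately have "q_weight Q s w (m + p) (n + \<alpha>) \<le> s ^ (1 + (m + n)) * Q powr (- w m n - real m)"
    using s unfolding q_weight_def by (intro mult_mono) auto
  then have "cmod (lam m) * q_weight Q s w (m + p) (n + \<alpha>)
      \<le> (\<Lambda> * Q ^ m) * (s ^ (1 + (m + n)) * Q powr (- w m n - real m))"
    using lam[of m] s \<Lambda> Q by (intro mult_mono) (auto simp: q_weight_def)
  also have "\<dots> = \<Lambda> * s * q_weight Q s w m n"
    using Q by (simp add: q_weight_def powr_diff powr_realpow)
  finally show ?thesis .
qed

text \<open>The increment is \<open>((m + p)\<^sup>2 - m\<^sup>2) / (2 p) = m + p / 2\<close>.\<close>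

lemma growth_exponent_gaussian:
  assumes "p > 0"
  shows "growth_exponent p \<alpha> (\<lambda>m n. (real m)\<^sup>2 / (2 * real p))"
  using assms
  by (auto simp: growth_exponent_def add_divide_distrib[symmetric] divide_simps power2_eq_square algebra_simps)

text \<open>Increasing \<open>n\<close> by \<open>\<alpha>\<close> increases \<open>\<lfloor>n / \<alpha>\<rfloor>\<close> by one, and so the exponent by at least \<open>m\<close>.\<close>

lemma growth_exponent_floor:
  assumes "\<alpha> > 0"
  shows "growth_exponent p \<alpha> (\<lambda>m n. real (m * (n div \<alpha>)))"
proof -
  have "m * (n div \<alpha>) + m' * (n' div \<alpha>) \<le> (m + m') * ((n + n') div \<alpha>)" for m n m' n'
  proof -
    have "n div \<alpha> \<le> (n + n') div \<alpha>" "n' div \<alpha> \<le> (n + n') div \<alpha>" by (auto intro: div_le_mono)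
    then show ?thesis by (simp add: add_mult_distrib add_mono mult_le_mono2)
  qed
  moreover have "m * (n div \<alpha>) + m \<le> (m + p) * ((n + \<alpha>) div \<alpha>)" for m n
    using assms by (simp add: algebra_simps)
  ultimately show ?thesis
    by (simp only: growth_exponent_def of_nat_0_le_iff of_nat_add[symmetric] of_nat_le_iff) blast
qed

text \<open>The numbers \<open>s\<close> and \<open>d\<close> are chosen before the exponent \<open>w\<close>, so that bounds from different exponents
  hold with the same radius and the same constants.\<close>

lemma unique_solution_weighted_bound:
  fixes F :: "complex \<times> complex \<times> (complex ^ 'n) \<Rightarrow> complex ^ 'n::finite"
    and op :: "complex fps fps \<Rightarrow> complex fps fps"
  assumes Q: "Q > 1" and \<alpha>: "\<alpha> > 0"
    and F: "power_series_at F (0, 0, 0) c"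
    and F0: "F (0, 0, 0) = 0"
    and jac: "invertible (jacobian_y F)"
    and op: "\<And>f m n. coeff2 (op f) m n =
      (if p \<le> m \<and> \<alpha> \<le> n then lam (m - p) * coeff2 f (m - p) (n - \<alpha>) else 0)"
    and \<Lambda>: "\<Lambda> > 0" and lam: "\<And>m. cmod (lam m) \<le> \<Lambda> * Q ^ m"
  shows "\<exists>y s d. 0 < s \<and> 0 < d \<and>
    (\<forall>z. (zero_constant_term z \<and> (\<chi> i. op (z $ i)) = formal_compose F z) \<longleftrightarrow> z = y) \<and>
    (\<forall>w N h. growth_exponent p \<alpha> w \<longrightarrow> wnorm (q_weight Q s w) N (y $ h) \<le> d)"
proof -
  have tc: "taylor_coeff F = c" by (rule taylor_coeff_eqI[OF F])
  have c0: "taylor_coeff F (0, 0, \<lambda>_. 0) = 0"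
    using power_series_constant_term[OF F] F0 by (simp add: tc)
  obtain B where B: "jacobian_y F ** B = mat 1" "B ** jacobian_y F = mat 1"
    using jac by (auto simp: invertible_def)
  interpret shifted_fixed_point c B lam p \<alpha> by unfold_locales (rule \<alpha>)
  have sol: "zero_constant_term z \<and> (\<chi> i. op (z $ i)) = formal_compose F z
      \<longleftrightarrow> (\<forall>l. order_ge 1 (z $ l)) \<and> fp_map z = z" for z
    by (rule formal_solution_iff_fixed_point[where J = "jacobian_y F"])
      (use c0 B in \<open>simp_all add: tc jacobian_y_taylor[OF F] op coeff2_shift\<close>)
  have iff: "zero_constant_term z \<and> (\<chi> i. op (z $ i)) = formal_compose F z \<longleftrightarrow> z = limit" for z
    unfolding sol using fixed_point_eq_limit[of z] order_ge_limit limit_fixed_point by auto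
  obtain \<rho> K where \<rho>K: "\<rho> > 0" "K > 0"
    "\<And>I h. finite I \<Longrightarrow> (\<Sum>a\<in>I. cmod (c a $ h) * \<rho> ^ index_degree a) \<le> K"
    by (rule taylor_coeff_abs_summable[OF F]) (rule that)
  define b where "b = 1 + (\<Sum>h\<in>UNIV. \<Sum>l\<in>UNIV. cmod (B $ h $ l))"
  have b: "b > 0" "(\<Sum>l\<in>UNIV. cmod (B $ h $ l)) \<le> b" for h
  proof -
    show "b > 0" by (simp add: b_def add_pos_nonneg sum_nonneg)
    have "(\<Sum>l\<in>UNIV. cmod (B $ h $ l)) \<le> (\<Sum>h\<in>UNIV. \<Sum>l\<in>UNIV. cmod (B $ h $ l))"
      by (rule member_le_sum) (auto intro: sum_nonneg)
    then show "(\<Sum>l\<in>UNIV. cmod (B $ h $ l)) \<le> b" by (simp add: b_def)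
  qed
  obtain s d where sd: "0 < s" "s \<le> 1" "s \<le> \<rho>" "0 < d" "d \<le> \<rho>"
    "b * (\<Lambda> * s * d + K * (s / \<rho> + (d / \<rho>)\<^sup>2)) \<le> d"
    using invariant_radius_exists[OF b(1) \<rho>K(2) \<Lambda> \<rho>K(1)] by blast
  have "wnorm (q_weight Q s w) N (limit $ h) \<le> d" if w: "growth_exponent p \<alpha> w" for w N h
  proof (rule wnorm_limit_le)
    show "submultiplicative_weight (q_weight Q s w) s"
      by (rule q_weight_submultiplicative[OF Q sd(1)]) (use w in \<open>auto simp: growth_exponent_def\<close>)
    show "cmod (lam m) * q_weight Q s w (m + p) (n + \<alpha>) \<le> \<Lambda> * s * q_weight Q s w m n" for m n
      by (rule q_weight_shift[OF Q sd(1,2) \<alpha> _ lam])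
        (use w \<Lambda> in \<open>auto simp: growth_exponent_def\<close>)
  qed (use \<rho>K sd b \<Lambda> in auto)
  with iff sd show ?thesis by blast
qed

section \<open>From weighted sums to bounds on discs\<close>

lemma bounded_power_series_disc:
  fixes f :: "complex fps"
  assumes R: "R > 0" and le: "\<And>M. (\<Sum>n\<le>M. cmod (fps_nth f n) * R ^ n) \<le> b"
  shows "f \<in> Ob R" and "cmod z < R \<Longrightarrow> cmod (eval_fps f z) \<le> b"
proof -
  have sR: "summable (\<lambda>n. cmod (fps_nth f n) * R ^ n)"
    by (rule bounded_imp_summable[of _ b]) (use R le in auto)
  have term_le: "cmod (fps_nth f n * z ^ n) \<le> cmod (fps_nth f n) * R ^ n" if "cmod z \<le> R" for z n
    using that by (simp add: norm_mult norm_power mult_left_mono power_mono)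
  have s: "summable (\<lambda>n. cmod (fps_nth f n * z ^ n))" if "cmod z \<le> R" for z
    by (rule summable_comparison_test'[OF sR, of 0]) (use term_le[OF that] in simp)
  have "norm (of_real R :: complex) \<le> fps_conv_radius f"
    unfolding fps_conv_radius_def
    by (rule conv_radius_geI, rule summable_norm_cancel, rule s) (use R in simp)
  then have rad: "ereal R \<le> fps_conv_radius f" using R by simp
  have bd: "cmod (eval_fps f z) \<le> b" if z: "cmod z < R" for z
  proof -
    have "cmod (eval_fps f z) \<le> suminf (\<lambda>n. cmod (fps_nth f n * z ^ n))"
      unfolding eval_fps_def by (rule summable_norm) (use s z in auto)
    also have "\<dots> \<le> suminf (\<lambda>n. cmod (fps_nth f n) * R ^ n)"
      by (intro suminf_le s sR term_le) (use z in auto)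
    also have "\<dots> \<le> b"
    proof (rule suminf_le_const[OF sR])
      fix M
      have "(\<Sum>n<M. cmod (fps_nth f n) * R ^ n) \<le> (\<Sum>n\<le>M. cmod (fps_nth f n) * R ^ n)"
        by (rule sum_mono2) (use R in auto)
      with le[of M] show "(\<Sum>n<M. cmod (fps_nth f n) * R ^ n) \<le> b" by linarith
    qed
    finally show ?thesis .
  qed
  show "cmod z < R \<Longrightarrow> cmod (eval_fps f z) \<le> b" by (rule bd)
  have "ball (0::complex) R \<subseteq> eball 0 (fps_conv_radius f)"
    using rad by (rule ball_eball_mono)
  then have "eval_fps f holomorphic_on ball 0 R"
    by (rule holomorphic_on_eval_fps)
  moreover have "bounded (eval_fps f ` ball 0 R)"
    by (rule boundedI[of _ b]) (use bd in auto)
  moreover have "\<forall>z\<in>ball 0 R. summable (\<lambda>n. fps_nth f n * z ^ n)"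
    using s summable_norm_cancel less_imp_le by (metis mem_ball_0)
  ultimately show "f \<in> Ob R" by (simp add: Ob_def)
qed

lemma disc_sup_le:
  fixes v :: "(complex fps) ^ 'n::finite"
  assumes "R > 0" "\<And>i z. cmod z < R \<Longrightarrow> cmod (eval_fps (v $ i) z) \<le> b"
  shows "disc_sup R v \<le> b"
  unfolding disc_sup_def maxnorm_def
  by (rule cSUP_least) (use assms in auto)

lemma weight_row_le:
  assumes "wnorm v (m + M) f \<le> d" "\<And>m n. 0 \<le> v m n"
  shows "(\<Sum>n\<le>M. cmod (coeff2 f m n) * v m n) \<le> d"
proof -
  have "(\<Sum>n\<le>M. cmod (coeff2 f m n) * v m n) = (\<Sum>(m, n)\<in>{m} \<times> {..M}. cmod (coeff2 f m n) * v m n)"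
    by (simp add: sum.cartesian_product[symmetric])
  also have "\<dots> \<le> wnorm v (m + M) f"
    unfolding wnorm_def
    by (rule sum_mono2) (use assms(2) finite_degree_triangle[of "m + M"] in \<open>auto simp: degree_triangle_def\<close>)
  finally show ?thesis using assms(1) by simp
qed

lemma weight_column_le:
  assumes "wnorm v (n + M) f \<le> d" "\<And>m n. 0 \<le> v m n"
  shows "(\<Sum>m\<le>M. cmod (coeff2 f m n) * v m n) \<le> d"
proof -
  have "(\<Sum>m\<le>M. cmod (coeff2 f m n) * v m n) = (\<Sum>(m, n)\<in>{..M} \<times> {n}. cmod (coeff2 f m n) * v m n)"
    by (simp add: sum.cartesian_product[symmetric])
  also have "\<dots> \<le> wnorm v (n + M) f"
    unfolding wnorm_def
    by (rule sum_mono2) (use assms(2) finite_degree_triangle[of "n + M"] in \<open>auto simp: degree_triangle_def\<close>)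
  finally show ?thesis using assms(1) by simp
qed

lemma row_sum_le:
  assumes "\<And>N. wnorm v N f \<le> d" "\<And>m n. 0 \<le> v m n" "\<And>n. R ^ n \<le> e * v m n" "0 \<le> e"
  shows "(\<Sum>n\<le>M. cmod (coeff2 f m n) * R ^ n) \<le> d * e"
proof -
  have "(\<Sum>n\<le>M. cmod (coeff2 f m n) * R ^ n) \<le> (\<Sum>n\<le>M. (cmod (coeff2 f m n) * v m n) * e)"
    using assms(3) by (intro sum_mono) (simp add: mult.assoc mult.commute[of "v m _"] mult_left_mono)
  also have "\<dots> \<le> d * e"
    unfolding sum_distrib_right[symmetric]
    by (intro mult_right_mono weight_row_le assms)
  finally show ?thesis .
qed

lemma column_sum_le:
  assumes "\<And>N. wnorm v N f \<le> d" "\<And>m n. 0 \<le> v m n" "\<And>m. R ^ m \<le> e * v m n" "0 \<le> e"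
  shows "(\<Sum>m\<le>M. cmod (coeff2 f m n) * R ^ m) \<le> d * e"
proof -
  have "(\<Sum>m\<le>M. cmod (coeff2 f m n) * R ^ m) \<le> (\<Sum>m\<le>M. (cmod (coeff2 f m n) * v m n) * e)"
    using assms(3) by (intro sum_mono) (simp add: mult.assoc mult.commute[of "v _ n"] mult_left_mono)
  also have "\<dots> \<le> d * e"
    unfolding sum_distrib_right[symmetric]
    by (intro mult_right_mono weight_column_le assms)
  finally show ?thesis .
qed

lemma x_coeff_disc_bound:
  fixes y :: "(complex fps fps) ^ 'n::finite"
  assumes "\<And>N h. wnorm v N (y $ h) \<le> d" "\<And>m n. 0 \<le> v m n" "\<And>n. R ^ n \<le> e * v m n" "0 \<le> e" "0 < R"
  shows "x_coeff y m $ i \<in> Ob R" "disc_sup R (x_coeff y m) \<le> d * e"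
proof -
  have *: "(\<Sum>n\<le>M. cmod (fps_nth (x_coeff y m $ h) n) * R ^ n) \<le> d * e" for h M
    using row_sum_le[OF assms(1-4), of h M] by (simp add: x_coeff_def)
  show "x_coeff y m $ i \<in> Ob R" by (rule bounded_power_series_disc(1)[OF assms(5) *])
  show "disc_sup R (x_coeff y m) \<le> d * e"
    by (rule disc_sup_le[OF assms(5)]) (rule bounded_power_series_disc(2)[OF assms(5) *])
qed

lemma eps_coeff_disc_bound:
  fixes y :: "(complex fps fps) ^ 'n::finite"
  assumes "\<And>N h. wnorm v N (y $ h) \<le> d" "\<And>m n. 0 \<le> v m n" "\<And>m. R ^ m \<le> e * v m n" "0 \<le> e" "0 < R"
  shows "eps_coeff y n $ i \<in> Ob R" "disc_sup R (eps_coeff y n) \<le> d * e"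
proof -
  have *: "(\<Sum>m\<le>M. cmod (fps_nth (eps_coeff y n $ h) m) * R ^ m) \<le> d * e" for h M
    using column_sum_le[OF assms(1-4), of h M] by (simp add: eps_coeff_def)
  show "eps_coeff y n $ i \<in> Ob R" by (rule bounded_power_series_disc(1)[OF assms(5) *])
  show "disc_sup R (eps_coeff y n) \<le> d * e"
    by (rule disc_sup_le[OF assms(5)]) (rule bounded_power_series_disc(2)[OF assms(5) *])
qed

text \<open>In each case the powers of the radius are at most a constant multiple of the weight along a row or a
  column of coefficients: the Gaussian exponent for rows on a fixed disc, the floor exponent otherwise.\<close>

lemma disc_estimates_of_weighted_bound:
  fixes y :: "(complex fps fps) ^ 'n::finite"
  assumes Q: "Q > 1" and \<alpha>: "\<alpha> > 0" and s: "s > 0"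
    and bound: "\<And>w N h. growth_exponent p \<alpha> w \<Longrightarrow> wnorm (q_weight Q s w) N (y $ h) \<le> d"
  shows "eps_coeff y n $ i \<in> Ob (s / Q ^ (n div \<alpha>))"
    and "disc_sup (s / Q ^ (n div \<alpha>)) (eps_coeff y n) \<le> d * (1 / s) ^ n"
    and "p > 0 \<Longrightarrow> x_coeff y n $ i \<in> Ob s"
    and "p > 0 \<Longrightarrow> disc_sup s (x_coeff y n) \<le> d * (1 / s) ^ n * Q powr ((real n)\<^sup>2 / (2 * real p))"
    and "x_coeff y n $ i \<in> Ob (s / Q powr (real n / real \<alpha>))"
    and "disc_sup (s / Q powr (real n / real \<alpha>)) (x_coeff y n) \<le> d * (1 / s) ^ n"
proof -
  have pos: "0 \<le> q_weight Q s w m n" for w m n using s by (simp add: q_weight_def)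
  \<comment> \<open>columns, and rows on shrinking discs: the floor exponent\<close>
  let ?w = "\<lambda>m n. real (m * (n div \<alpha>))"
  note floor_bound = bound[OF growth_exponent_floor[OF \<alpha>]]
  have col: "(s / Q ^ (n div \<alpha>)) ^ m \<le> (1 / s) ^ n * q_weight Q s ?w m n" for m
  proof -
    have "Q powr (- ?w m n) = 1 / Q ^ (m * (n div \<alpha>))"
      using Q by (simp only: powr_minus_divide) (simp add: powr_realpow del: of_nat_mult)
    then show ?thesis
      using s by (simp add: q_weight_def power_divide power_add power_mult[symmetric] mult.commute del: of_nat_mult)
  qed
  show "eps_coeff y n $ i \<in> Ob (s / Q ^ (n div \<alpha>))"
    "disc_sup (s / Q ^ (n div \<alpha>)) (eps_coeff y n) \<le> d * (1 / s) ^ n"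
    using eps_coeff_disc_bound[OF floor_bound pos col] s Q by auto
  have row: "(s / Q powr (real n / real \<alpha>)) ^ m \<le> (1 / s) ^ n * q_weight Q s ?w n m" for m
  proof -
    have "real (n * (m div \<alpha>)) \<le> real n / real \<alpha> * real m"
      using mult_left_mono[OF of_nat_div_le_of_nat[of m \<alpha>], of "real n"] by (simp add: mult_ac)
    then have "Q powr (- (real n / real \<alpha> * real m)) \<le> Q powr (- ?w n m)"
      using Q by (intro powr_mono) auto
    moreover have "(Q powr (real n / real \<alpha>)) ^ m = Q powr (real n / real \<alpha> * real m)"
      using Q by (subst powr_realpow[symmetric]) (auto simp: powr_powr)
    ultimately have "s ^ m * (1 / (Q powr (real n / real \<alpha>)) ^ m) \<le> s ^ m * Q powr (- ?w n m)"
      using s by (intro mult_left_mono) (auto simp: powr_minus_divide)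
    then show ?thesis
      using s by (simp add: q_weight_def power_divide power_add del: of_nat_mult)
  qed
  show "x_coeff y n $ i \<in> Ob (s / Q powr (real n / real \<alpha>))"
    "disc_sup (s / Q powr (real n / real \<alpha>)) (x_coeff y n) \<le> d * (1 / s) ^ n"
    using x_coeff_disc_bound[OF floor_bound pos row] s Q by auto
  \<comment> \<open>rows on a fixed disc: the Gaussian exponent\<close>
  let ?g = "\<lambda>m n :: nat. (real m)\<^sup>2 / (2 * real p)"
  let ?e = "(1 / s) ^ n * Q powr ((real n)\<^sup>2 / (2 * real p))"
  assume p: "p > 0"
  have "s ^ m \<le> ?e * q_weight Q s ?g n m" for m
    using s Q by (simp add: q_weight_def power_divide power_add powr_minus)
  from x_coeff_disc_bound[OF bound[OF growth_exponent_gaussian[OF p]] pos this]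
  show "x_coeff y n $ i \<in> Ob s"
    "disc_sup s (x_coeff y n) \<le> d * (1 / s) ^ n * Q powr ((real n)\<^sup>2 / (2 * real p))"
    using s Q by (auto simp: mult.assoc)
qed

section \<open>The two systems\<close>

lemma coeff2_sigma_system:
  "coeff2 (Eps ^ \<alpha> * X ^ p * sigma_q q f) m n =
    (if p \<le> m \<and> \<alpha> \<le> n then q ^ (m - p) * coeff2 f (m - p) (n - \<alpha>) else 0)"
  by (simp add: coeff2_Eps_X_mult sigma_q_def)

text \<open>The coefficient of \<open>x\<^sup>p\<close> also has the stated form, because \<open>[0]\<^sub>q = 0\<close>.\<close>

lemma coeff2_d_system:
  "coeff2 (Eps ^ \<alpha> * X ^ (p + 1) * d_q q f) m n =
    (if p \<le> m \<and> \<alpha> \<le> n then q_number q (m - p) * coeff2 f (m - p) (n - \<alpha>) else 0)"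
proof (cases "m = p")
  case True
  then show ?thesis by (simp only: coeff2_Eps_X_mult) (simp add: q_number_def)
next
  case False
  then have "Suc (m - (p + 1)) = m - p" if "p \<le> m" using that by simp
  with False show ?thesis
    by (simp only: coeff2_Eps_X_mult d_q_def fps_nth_Abs_fps fps_mult_left_const_nth) auto
qed

lemma norm_q_number_le:
  assumes "cmod q > 1"
  shows "cmod (q_number q m) \<le> 2 / cmod (q - 1) * cmod q ^ m"
proof -
  have "cmod (q ^ m - 1) \<le> cmod q ^ m + 1"
    using norm_triangle_ineq4[of "q ^ m" 1] by (simp add: norm_power)
  also have "\<dots> \<le> 2 * cmod q ^ m"
    using one_le_power[of "cmod q" m] assms by simp
  finally show ?thesis
    by (simp add: q_number_def norm_divide divide_right_mono)
qed

theorem theorem1p1: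
  fixes q :: complex and p \<alpha> :: nat
    and F :: "complex \<times> complex \<times> (complex ^ 'n) \<Rightarrow> complex ^ 'n::finite"
  assumes q: "cmod q > 1"
    and \<alpha>: "\<alpha> > 0"
    and analytic: "\<exists>U. open U \<and> (0, 0, 0) \<in> U \<and> analytic_on3 F U"
    and F0: "F (0, 0, 0) = 0"
    and jac: "invertible (jacobian_y F)"
  shows "\<forall>is_solution \<in> {formal_solution_d q p \<alpha> F, formal_solution_sigma q p \<alpha> F}.
    (\<exists>!y. is_solution y) \<and>
    (\<forall>y. is_solution y \<longrightarrow>
      (p > 0 \<longrightarrow>
        (\<exists>r>0.
          (\<forall>n i. x_coeff y n $ i \<in> Ob r \<and> eps_coeff y n $ i \<in> Ob (r / cmod q ^ (n div \<alpha>))) \<and>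
          (\<exists>C>0. \<exists>A>0. \<forall>n.
            disc_sup r (x_coeff y n) \<le> C * A ^ n * cmod q powr ((real n)\<^sup>2 / (2 * real p)) \<and>
            disc_sup (r / cmod q ^ (n div \<alpha>)) (eps_coeff y n) \<le> C * A ^ n))) \<and>
      (p = 0 \<longrightarrow>
        (\<exists>r>0.
          (\<forall>n i. x_coeff y n $ i \<in> Ob (r / cmod q powr (real n / real \<alpha>)) \<and>
                 eps_coeff y n $ i \<in> Ob (r / cmod q ^ (n div \<alpha>))) \<and>
          (\<exists>C>0. \<exists>A>0. \<forall>n.
            disc_sup (r / cmod q powr (real n / real \<alpha>)) (x_coeff y n) \<le> C * A ^ n \<and>
            disc_sup (r / cmod q ^ (n div \<alpha>)) (eps_coeff y n) \<le> C * A ^ n))))"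
proof
  fix is_solution
  assume is_solution: "is_solution \<in> {formal_solution_d q p \<alpha> F, formal_solution_sigma q p \<alpha> F}"
  obtain c where c: "power_series_at F (0, 0, 0) c"
    using analytic by (auto simp: analytic_on3_def)
  have "\<exists>y s d. 0 < s \<and> 0 < d \<and> (\<forall>z. is_solution z \<longleftrightarrow> z = y) \<and>
      (\<forall>w N h. growth_exponent p \<alpha> w \<longrightarrow> wnorm (q_weight (cmod q) s w) N (y $ h) \<le> d)"
    using is_solution
  proof (elim insertE emptyE)
    assume sol: "is_solution = formal_solution_d q p \<alpha> F"
    have "q \<noteq> 1" using q by auto
    then have "2 / cmod (q - 1) > 0" by simp
    from unique_solution_weighted_bound[OF q \<alpha> c F0 jac coeff2_d_system this norm_q_number_le[OF q]]
    show ?thesis unfolding sol formal_solution_d_def by simp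
  next
    assume sol: "is_solution = formal_solution_sigma q p \<alpha> F"
    have "cmod (q ^ m) \<le> 1 * cmod q ^ m" for m by (simp add: norm_power)
    from unique_solution_weighted_bound[OF q \<alpha> c F0 jac coeff2_sigma_system zero_less_one this]
    show ?thesis unfolding sol formal_solution_sigma_def by simp
  qed
  then obtain y s d where s: "0 < s" and d: "0 < d" and y: "\<And>z. is_solution z \<longleftrightarrow> z = y"
    and bound: "\<And>w N h. growth_exponent p \<alpha> w \<Longrightarrow> wnorm (q_weight (cmod q) s w) N (y $ h) \<le> d"
    by blast
  note est = disc_estimates_of_weighted_bound[OF q \<alpha> s bound]
  have A: "0 < 1 / s" using s by simp
  show "(\<exists>!y. is_solution y) \<and>
    (\<forall>y. is_solution y \<longrightarrow>
      (p > 0 \<longrightarrow>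
        (\<exists>r>0.
          (\<forall>n i. x_coeff y n $ i \<in> Ob r \<and> eps_coeff y n $ i \<in> Ob (r / cmod q ^ (n div \<alpha>))) \<and>
          (\<exists>C>0. \<exists>A>0. \<forall>n.
            disc_sup r (x_coeff y n) \<le> C * A ^ n * cmod q powr ((real n)\<^sup>2 / (2 * real p)) \<and>
            disc_sup (r / cmod q ^ (n div \<alpha>)) (eps_coeff y n) \<le> C * A ^ n))) \<and>
      (p = 0 \<longrightarrow>
        (\<exists>r>0.
          (\<forall>n i. x_coeff y n $ i \<in> Ob (r / cmod q powr (real n / real \<alpha>)) \<and>
                 eps_coeff y n $ i \<in> Ob (r / cmod q ^ (n div \<alpha>))) \<and>
          (\<exists>C>0. \<exists>A>0. \<forall>n.
            disc_sup (r / cmod q powr (real n / real \<alpha>)) (x_coeff y n) \<le> C * A ^ n \<and>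
            disc_sup (r / cmod q ^ (n div \<alpha>)) (eps_coeff y n) \<le> C * A ^ n))))"
    unfolding y
  proof (intro conjI allI impI, goal_cases)
    case 1
    show ?case by simp
  next
    case (2 z)
    have "\<forall>n. disc_sup s (x_coeff y n) \<le> d * (1 / s) ^ n * cmod q powr ((real n)\<^sup>2 / (2 * real p)) \<and>
        disc_sup (s / cmod q ^ (n div \<alpha>)) (eps_coeff y n) \<le> d * (1 / s) ^ n"
      by (intro allI conjI est) (use \<open>p > 0\<close> in auto)
    moreover have "\<forall>n i. x_coeff y n $ i \<in> Ob s \<and> eps_coeff y n $ i \<in> Ob (s / cmod q ^ (n div \<alpha>))"
      by (intro allI conjI est) (use \<open>p > 0\<close> in auto)
    ultimately show ?case unfolding \<open>z = y\<close> using s d A by blast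
  next
    case (3 z)
    have "\<forall>n. disc_sup (s / cmod q powr (real n / real \<alpha>)) (x_coeff y n) \<le> d * (1 / s) ^ n \<and>
        disc_sup (s / cmod q ^ (n div \<alpha>)) (eps_coeff y n) \<le> d * (1 / s) ^ n"
      by (intro allI conjI est)
    moreover have "\<forall>n i. x_coeff y n $ i \<in> Ob (s / cmod q powr (real n / real \<alpha>)) \<and>
        eps_coeff y n $ i \<in> Ob (s / cmod q ^ (n div \<alpha>))"
      by (intro allI conjI est)
    ultimately show ?case unfolding \<open>z = y\<close> using s d A by blast
  qed
qed

end
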